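(* For each standard machine $U$ there exists a positive number $e$ such that there is no pair consisting of a computable function $t(n)$ and a (deterministic) algorithm that on every input $(x, C_U(x))$ outputs a $|x|/e$-short program for $x$ (relative to $U$) in time $t(|x|)$.
   Context: A universal Turing machine $U$ is standard if for every machine $V$ there is a polynomial-time computable function $\tau$ such that, for all $p$, $U(\tau(p)) = V(p)$ and $|\tau(p)| = |p| + O(1)$. $C_U(x) = \min\{|p| : U(p)=x\}$ is the plain Kolmogorov complexity of $x$ relative to $U$. A string $p$ with $U(p)=x$ and $|p| \le C_U(x)+c$ is called a $c$-short program for $x$. The algorithm is only required to behave correctly (and to run within time $t(|x|)$) on inputs $(x,\ell)$ with $\ell = C_U(x)$; on other inputs it may output anything or not halt. *)

theory Defs
  imports Complex_Main
begin

text \<open>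
  Deterministic Turing machines with one two-way infinite tape. A machine is a finite table
  of entries \<open>((q, a), (q', b, d))\<close>: in state \<open>q\<close> scanning \<open>a\<close>, write \<open>b\<close>, move in direction \<open>d\<close>
  and go to state \<open>q'\<close>. If several entries have the same key, the first one counts; if there is
  none, the machine halts. States and symbols are natural numbers, only finitely many of which
  occur in a given table. State 0 is initial, symbol 0 is the blank, symbols 1 and 2 are the
  bits 0 and 1; all other symbols are auxiliary.
\<close>

datatype dir = Left | Right | Stay

type_synonym tm = "((nat \<times> nat) \<times> (nat \<times> nat \<times> dir)) list"

text \<open>
  A configuration \<open>(q, l, r)\<close> consists of the state, the tape to the left of the head (nearest
  cell first), and the tape from the scanned cell to the right. Cells beyond the lists are blank.
\<close>

type_synonym config = "nat \<times> nat list \<times> nat list"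

definition scan :: "nat list \<Rightarrow> nat" where
  "scan r = (case r of [] \<Rightarrow> 0 | a # _ \<Rightarrow> a)"

fun write_move :: "nat \<Rightarrow> dir \<Rightarrow> nat list \<Rightarrow> nat list \<Rightarrow> nat list \<times> nat list" where
  "write_move b Left l r = (tl l, scan l # b # tl r)"
| "write_move b Right l r = (b # l, tl r)"
| "write_move b Stay l r = (l, b # tl r)"

fun halted :: "tm \<Rightarrow> config \<Rightarrow> bool" where
  "halted M (q, l, r) \<longleftrightarrow> map_of M (q, scan r) = None"

fun step :: "tm \<Rightarrow> config \<Rightarrow> config" where
  "step M (q, l, r) = (case map_of M (q, scan r) of
      None \<Rightarrow> (q, l, r)
    | Some (q', b, d) \<Rightarrow> (q', write_move b d l r))"

definition bit_symbol :: "bool \<Rightarrow> nat" where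
  "bit_symbol b = (if b then 2 else 1)"

definition initial :: "bool list \<Rightarrow> config" where
  "initial w = (0, [], map bit_symbol w)"

text \<open>The output is the longest block of bits that starts at the scanned cell.\<close>

fun tape_output :: "config \<Rightarrow> bool list" where
  "tape_output (q, l, r) = map (\<lambda>a. a = 2) (takeWhile (\<lambda>a. a \<in> {1, 2}) r)"

definition config_at :: "tm \<Rightarrow> bool list \<Rightarrow> nat \<Rightarrow> config" where
  "config_at M w n = (step M ^^ n) (initial w)"

text \<open>
  Since \<^const>\<open>step\<close> leaves halted configurations unchanged, the following says that \<open>M\<close> halts on
  \<open>w\<close> after at most \<open>n\<close> steps with output \<open>y\<close>.
\<close>

definition outputs_within :: "tm \<Rightarrow> bool list \<Rightarrow> nat \<Rightarrow> bool list \<Rightarrow> bool" where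
  "outputs_within M w n y \<longleftrightarrow> halted M (config_at M w n) \<and> tape_output (config_at M w n) = y"

text \<open>The partial function computed by a machine; \<^const>\<open>None\<close> means that it does not halt.\<close>

definition eval_tm :: "tm \<Rightarrow> bool list \<Rightarrow> bool list option" where
  "eval_tm M w = (if \<exists>n. halted M (config_at M w n)
     then Some (tape_output (config_at M w (LEAST n. halted M (config_at M w n))))
     else None)"

definition polytime_computable :: "(bool list \<Rightarrow> bool list) \<Rightarrow> bool" where
  "polytime_computable f \<longleftrightarrow>
     (\<exists>M c k. \<forall>w. outputs_within M w (c * length w ^ k + c) (f w))"

text \<open>Binary notation, most significant bit first; 0 is represented by the empty string.\<close>

fun binary :: "nat \<Rightarrow> bool list" where
  "binary n = (if n = 0 then [] else binary (n div 2) @ [odd n])"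

declare binary.simps [simp del]

definition computable_nat :: "(nat \<Rightarrow> nat) \<Rightarrow> bool" where
  "computable_nat t \<longleftrightarrow> (\<exists>M. \<forall>n. eval_tm M (binary n) = Some (binary (t n)))"

text \<open>Injective encoding of a pair: the bits of \<open>x\<close> doubled, the separator 01, then \<open>y\<close>.\<close>

definition pair_code :: "bool list \<Rightarrow> bool list \<Rightarrow> bool list" where
  "pair_code x y = concat (map (\<lambda>b. [b, b]) x) @ [False, True] @ y"

text \<open>
  The equation between the values of \<open>U\<close> and \<open>V\<close> is one of partial functions, so it includes
  that either both sides are defined or neither is. In particular a standard machine is
  universal.
\<close>

definition standard :: "tm \<Rightarrow> bool" where
  "standard U \<longleftrightarrow> (\<forall>V. \<exists>\<tau>. polytime_computable \<tau>
     \<and> (\<forall>p. eval_tm U (\<tau> p) = eval_tm V p)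
     \<and> (\<exists>c. \<forall>p. \<bar>int (length (\<tau> p)) - int (length p)\<bar> \<le> c))"

text \<open>
  The minimum exists for every \<open>x\<close> if \<open>U\<close> is standard; where there is no program for \<open>x\<close> the
  value is unspecified.
\<close>

definition plain_complexity :: "tm \<Rightarrow> bool list \<Rightarrow> nat" where
  "plain_complexity U x = (LEAST n. \<exists>p. eval_tm U p = Some x \<and> length p = n)"

definition short_program :: "tm \<Rightarrow> real \<Rightarrow> bool list \<Rightarrow> bool list \<Rightarrow> bool" where
  "short_program U c x p \<longleftrightarrow>
     eval_tm U p = Some x \<and> real (length p) \<le> real (plain_complexity U x) + c"

end

theory Submission
  imports Defs "HOL-Library.Nat_Bijection"
begin

text \<open>
  Fix a candidate pair of a time bound \<open>t\<close> and an algorithm \<open>A\<close>. For words of a fixed length \<open>n\<close> and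
  for every \<open>l\<close> in a window of \<open>j\<close> consecutive numbers starting at \<open>k - 1\<close>, with \<open>n = 4 j k\<close>, consider
  the output of \<open>A\<close> on \<open>(x, l)\<close> after \<open>t n\<close> steps, ignoring outputs that are longer than \<open>3 k\<close>. There
  are at most \<open>2 ^ (j (3 k + 2))\<close> vectors of such outputs, so at least \<open>2 ^ k\<close> words share the same
  vector, and a machine \<open>V\<close> can find them and let each program of length \<open>k\<close> print one of them. All
  these words have complexity at most \<open>k + c\<close>, at least half of them have complexity at least
  \<open>k - 1\<close>, hence two of them have the same complexity \<open>l\<close> in the window. On these two words \<open>A\<close> outputs
  the same program, which cannot be correct for both.

  The window length \<open>j\<close>, and with it \<open>e = 4 j\<close>, must exceed the overhead \<open>c\<close> of \<open>U\<close> on \<open>V\<close>, so neither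
  may depend on \<open>t\<close>, \<open>A\<close>. Therefore \<open>V\<close> is a single machine that decodes \<open>j\<close>, \<open>A\<close> and a machine for
  \<open>t\<close> from the length \<open>k\<close> of its input.
\<close>

section \<open>Stack programs on Turing machines\<close>

text \<open>An intermediate language in which every test looks at a single stack, so that each
  construct compiles to a fixed block of states. The top of a stack is the last element of its
  list.\<close>

datatype com = Push nat bool | Pop nat | Seq com com | Loop nat com | Cond nat com com

type_synonym stacks = "nat \<Rightarrow> bool list"

definition top_true :: "bool list \<Rightarrow> bool" where
  "top_true w \<longleftrightarrow> w \<noteq> [] \<and> last w"

text \<open>A big-step relation rather than a function, since loops may diverge; only terminating
  executions have to be simulated.\<close>

inductive exec :: "com \<Rightarrow> stacks \<Rightarrow> stacks \<Rightarrow> bool" where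
  Push: "exec (Push j b) s (s(j := s j @ [b]))"
| Pop: "exec (Pop j) s (s(j := butlast (s j)))"
| Seq: "exec c s s' \<Longrightarrow> exec d s' s'' \<Longrightarrow> exec (Seq c d) s s''"
| Loop_done: "s j = [] \<Longrightarrow> exec (Loop j c) s s"
| Loop_step: "s j \<noteq> [] \<Longrightarrow> exec c s s' \<Longrightarrow> exec (Loop j c) s' s'' \<Longrightarrow> exec (Loop j c) s s''"
| Cond_True: "top_true (s j) \<Longrightarrow> exec c s s' \<Longrightarrow> exec (Cond j c d) s s'"
| Cond_False: "\<not> top_true (s j) \<Longrightarrow> exec d s s' \<Longrightarrow> exec (Cond j c d) s s'"

fun width :: "com \<Rightarrow> nat" where
  "width (Push j b) = Suc j"
| "width (Pop j) = Suc j"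
| "width (Seq c d) = max (width c) (width d)"
| "width (Loop j c) = max (Suc j) (width c)"
| "width (Cond j c d) = max (Suc j) (max (width c) (width d))"

text \<open>Size of the block of states compiled from a program. A block is entered at its first
  state \<open>q0\<close> and left for \<open>q0 + states c\<close>, both times with the head on
  cell 1.\<close>

fun states :: "com \<Rightarrow> nat" where
  "states (Push j b) = 2"
| "states (Pop j) = 3"
| "states (Seq c d) = states c + states d"
| "states (Loop j c) = states c + 2"
| "states (Cond j c d) = states c + states d + 5"

text \<open>One tape symbol holds a cell of each of \<open>m\<close> tracks as base 3 digits; 0, 1
  and 2 keep their meaning as blank and bits.\<close>

definition digit :: "nat \<Rightarrow> nat \<Rightarrow> nat" where
  "digit j a = a div 3 ^ j mod 3"

definition symbol :: "nat \<Rightarrow> (nat \<Rightarrow> nat) \<Rightarrow> nat" where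
  "symbol m g = (\<Sum>j<m. g j * 3 ^ j)"

definition cell :: "bool list \<Rightarrow> nat \<Rightarrow> nat" where
  "cell w i = (if i < length w then bit_symbol (w ! i) else 0)"

text \<open>
  Stack \<open>j\<close> occupies track \<open>j\<close> of the tape, with its top at the right end, so that the raw input is
  already an encoded state. Cell 0 holds a left end marker.
\<close>

definition tape :: "nat \<Rightarrow> stacks \<Rightarrow> nat \<Rightarrow> nat" where
  "tape m s i = (if i = 0 then 3 ^ m else symbol m (\<lambda>j. cell (s j) (i - 1)))"

definition rewind :: "nat \<Rightarrow> nat \<Rightarrow> nat \<Rightarrow> nat \<Rightarrow> nat \<times> nat \<times> dir" where
  "rewind m q q' a = (if a = 3 ^ m then (q', a, Right) else (q, a, Left))"

definition find_top :: "nat \<Rightarrow> nat \<Rightarrow> nat \<Rightarrow> nat \<Rightarrow> nat \<times> nat \<times> dir" where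
  "find_top j q q' a = (if digit j a \<noteq> 0 then (q, a, Right) else (q', a, Left))"

text \<open>After \<open>find_top\<close> the head is on the top of the stack, or on the left end
  marker if the stack is empty. This is how \<open>Pop\<close> and \<open>Cond\<close> recognise an
  empty stack.\<close>

fun trans :: "nat \<Rightarrow> com \<Rightarrow> nat \<Rightarrow> nat \<Rightarrow> nat \<Rightarrow> nat \<times> nat \<times> dir" where
  "trans m (Push j b) q0 q a =
    (if q = q0 then if digit j a \<noteq> 0 then (q0, a, Right) else (q0 + 1, a + bit_symbol b * 3 ^ j, Left)
     else rewind m (q0 + 1) (q0 + 2) a)"
| "trans m (Pop j) q0 q a =
    (if q = q0 then find_top j q0 (q0 + 1) a
     else if q = q0 + 1 then if a = 3 ^ m then (q0 + 3, a, Right)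
       else (q0 + 2, a - digit j a * 3 ^ j, Left)
     else rewind m (q0 + 2) (q0 + 3) a)"
| "trans m (Seq c d) q0 q a =
    (if q < q0 + states c then trans m c q0 q a else trans m d (q0 + states c) q a)"
| "trans m (Loop j c) q0 q a =
    (if q = q0 then if digit j a = 0 then (q0 + states c + 2, a, Stay) else (q0 + 1, a, Stay)
     else if q < q0 + 1 + states c then trans m c (q0 + 1) q a
     else (q0, a, Stay))"
| "trans m (Cond j c d) q0 q a =
    (if q = q0 then find_top j q0 (q0 + 1) a
     else if q = q0 + 1 then if a = 3 ^ m then (q0 + 5 + states c, a, Right)
       else if digit j a = 2 then (q0 + 2, a, Left) else (q0 + 3, a, Left)
     else if q = q0 + 2 then rewind m (q0 + 2) (q0 + 4) a
     else if q = q0 + 3 then rewind m (q0 + 3) (q0 + 5 + states c) a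
     else if q < q0 + 4 + states c then trans m c (q0 + 4) q a
     else if q = q0 + 4 + states c then (q0 + 5 + states c + states d, a, Stay)
     else trans m d (q0 + 5 + states c) q a)"

section \<open>Base 3 arithmetic of tape symbols\<close>

lemma symbol_Suc: "symbol (Suc m) g = g 0 + 3 * symbol m (\<lambda>j. g (Suc j))"
  unfolding symbol_def by (subst sum.lessThan_Suc_shift) (simp add: sum_distrib_left algebra_simps)

text \<open>Consequently \<open>3 ^ m\<close> does not code any tuple of cells and is free to serve
  as the end marker.\<close>

lemma symbol_less: "(\<And>j. g j < 3) \<Longrightarrow> symbol m g < 3 ^ m"
proof (induction m arbitrary: g)
  case (Suc m)
  have "symbol m (\<lambda>j. g (Suc j)) < 3 ^ m" "g 0 < 3" using Suc by auto
  then show ?case by (simp add: symbol_Suc)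
qed (simp add: symbol_def)

lemma digit_symbol: "(\<And>j. g j < 3) \<Longrightarrow> j < m \<Longrightarrow> digit j (symbol m g) = g j"
proof (induction m arbitrary: g j)
  case (Suc m)
  have "g 0 < 3" using Suc.prems by auto
  show ?case
  proof (cases j)
    case 0
    then show ?thesis using \<open>g 0 < 3\<close> by (simp add: symbol_Suc digit_def)
  next
    case (Suc i)
    have "digit j (symbol (Suc m) g) = digit i (symbol m (\<lambda>j. g (Suc j)))"
      using \<open>g 0 < 3\<close> by (simp add: Suc symbol_Suc digit_def div_mult2_eq)
    then show ?thesis using Suc.IH[of "\<lambda>j. g (Suc j)" i] Suc.prems Suc by simp
  qed
qed simp

text \<open>Stated with additions on both sides because subtraction on \<open>nat\<close>
  truncates.\<close>

lemma symbol_upd: "j < m \<Longrightarrow> symbol m (g(j := d)) + g j * 3 ^ j = symbol m g + d * 3 ^ j"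
  unfolding symbol_def by (simp add: sum.remove[of "{..<m}" j])

lemma cell_less: "cell w i < 3"
  by (simp add: cell_def bit_symbol_def)

lemma digit_tape: "j < m \<Longrightarrow> digit j (tape m s (Suc i)) = cell (s j) i"
  by (simp add: tape_def digit_symbol cell_less)

lemma tape_neq_marker: "i > 0 \<Longrightarrow> tape m s i \<noteq> 3 ^ m"
  using symbol_less[of "\<lambda>j. cell (s j) (i - 1)" m] by (simp add: tape_def cell_less)

lemma tape_le: "tape m s i \<le> 3 ^ m"
  using symbol_less[of "\<lambda>j. cell (s j) (i - 1)" m] by (simp add: tape_def cell_less)

text \<open>Pushing and popping affect one cell of one track, hence one tape symbol. The new digit
  is added before the old one is subtracted, so nothing is truncated.\<close>

lemma tape_upd:
  assumes "j < m" and "\<And>k. k \<noteq> i \<Longrightarrow> cell w k = cell (s j) k"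
  shows "tape m (s(j := w)) = (tape m s)(Suc i := tape m s (Suc i) + cell w i * 3 ^ j - cell (s j) i * 3 ^ j)"
proof
  fix n
  show "tape m (s(j := w)) n = ((tape m s)(Suc i := tape m s (Suc i) + cell w i * 3 ^ j - cell (s j) i * 3 ^ j)) n"
  proof (cases n)
    case (Suc k)
    have "(\<lambda>j'. cell ((s(j := w)) j') k) = (\<lambda>j'. cell (s j') k)(j := cell w k)" by auto
    then have "tape m (s(j := w)) (Suc k) + cell (s j) k * 3 ^ j = tape m s (Suc k) + cell w k * 3 ^ j"
      using symbol_upd[OF assms(1), of "\<lambda>j'. cell (s j') k" "cell w k"] by (simp add: tape_def)
    then show ?thesis using Suc assms(2)[of k] by auto
  qed (simp add: tape_def)
qed

text \<open>The left list is fixed exactly, which keeps the head from passing cell 0; the right list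
  matters only up to trailing blanks.\<close>

definition represents :: "(nat \<Rightarrow> nat) \<Rightarrow> nat \<Rightarrow> nat list \<Rightarrow> nat list \<Rightarrow> bool" where
  "represents f i l r \<longleftrightarrow> l = rev (map f [0..<i]) \<and>
     (\<forall>k. f (i + k) = (if k < length r then r ! k else 0))"

text \<open>The number of steps stays existential: for compiled machines only halting and the output
  matter.\<close>

definition runs :: "tm \<Rightarrow> nat \<Rightarrow> (nat \<Rightarrow> nat) \<Rightarrow> nat \<Rightarrow> nat \<Rightarrow> (nat \<Rightarrow> nat) \<Rightarrow> nat \<Rightarrow> bool" where
  "runs M q f i q' f' i' \<longleftrightarrow> (\<forall>l r. represents f i l r \<longrightarrow>
     (\<exists>n l' r'. (step M ^^ n) (q, l, r) = (q', l', r') \<and> represents f' i' l' r'))"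

lemma runs_refl: "runs M q f i q f i"
  unfolding runs_def by (metis funpow_0)

lemma runs_trans [trans]:
  assumes "runs M q f i q' f' i'" "runs M q' f' i' q'' f'' i''"
  shows "runs M q f i q'' f'' i''"
  unfolding runs_def
proof (intro allI impI)
  fix l r assume "represents f i l r"
  then obtain n l' r' where 1: "(step M ^^ n) (q, l, r) = (q', l', r')" "represents f' i' l' r'"
    using assms(1) unfolding runs_def by blast
  then obtain k l'' r'' where 2: "(step M ^^ k) (q', l', r') = (q'', l'', r'')" "represents f'' i'' l'' r''"
    using assms(2) unfolding runs_def by blast
  have "(step M ^^ (k + n)) (q, l, r) = (q'', l'', r'')" using 1 2 by (simp add: funpow_add)
  then show "\<exists>n l' r'. (step M ^^ n) (q, l, r) = (q'', l', r') \<and> represents f'' i'' l' r'"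
    using 2 by blast
qed

lemma represents_scan: "represents f i l r \<Longrightarrow> scan r = f i"
  unfolding represents_def scan_def by (cases r) (auto dest: spec[of _ 0])

lemma represents_tl: "represents f i l r \<Longrightarrow> f (i + Suc k) = (if k < length (tl r) then tl r ! k else 0)"
  unfolding represents_def by (cases r) (auto dest: spec[of _ "Suc k"])

lemma runs_Right:
  assumes "map_of M (q, f i) = Some (q', b, Right)"
  shows "runs M q f i q' (f(i := b)) (Suc i)"
  unfolding runs_def
proof (intro allI impI)
  fix l r assume r: "represents f i l r"
  have "(step M ^^ 1) (q, l, r) = (q', b # l, tl r)"
    using assms by (simp add: represents_scan[OF r])
  moreover have "represents (f(i := b)) (Suc i) (b # l) (tl r)"
    using r represents_tl[OF r] unfolding represents_def by simp
  ultimately show "\<exists>n l' r'. (step M ^^ n) (q, l, r) = (q', l', r') \<and> represents (f(i := b)) (Suc i) l' r'"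
    by blast
qed

lemma runs_Stay:
  assumes "map_of M (q, f i) = Some (q', f i, Stay)"
  shows "runs M q f i q' f i"
  unfolding runs_def
proof (intro allI impI)
  fix l r assume r: "represents f i l r"
  have "(step M ^^ 1) (q, l, r) = (q', l, f i # tl r)"
    using assms by (simp add: represents_scan[OF r])
  moreover have "f (i + k) = (if k < length (f i # tl r) then (f i # tl r) ! k else 0)" for k
    using represents_tl[OF r] by (cases k) auto
  then have "represents f i l (f i # tl r)"
    using r unfolding represents_def by blast
  ultimately show "\<exists>n l' r'. (step M ^^ n) (q, l, r) = (q', l', r') \<and> represents f i l' r'"
    by blast
qed

lemma runs_Left:
  assumes "map_of M (q, f (Suc i)) = Some (q', b, Left)"
  shows "runs M q f (Suc i) q' (f(Suc i := b)) i"
  unfolding runs_def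
proof (intro allI impI)
  fix l r assume r: "represents f (Suc i) l r"
  have l: "l = f i # rev (map f [0..<i])" using r by (simp add: represents_def)
  have "(step M ^^ 1) (q, l, r) = (q', rev (map f [0..<i]), f i # b # tl r)"
    using assms by (simp add: represents_scan[OF r] l) (simp add: scan_def)
  moreover have "(f(Suc i := b)) (i + k) = (if k < length (f i # b # tl r) then (f i # b # tl r) ! k else 0)" for k
  proof (cases k)
    case (Suc k')
    then show ?thesis using represents_tl[OF r] by (cases k') auto
  qed simp
  then have "represents (f(Suc i := b)) i (rev (map f [0..<i])) (f i # b # tl r)"
    using r unfolding represents_def by auto
  ultimately show "\<exists>n l' r'. (step M ^^ n) (q, l, r) = (q', l', r') \<and> represents (f(Suc i := b)) i l' r'"
    by blast
qed

lemma runs_walk: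
  assumes "\<And>k. i \<le> k \<Longrightarrow> k < i + d \<Longrightarrow> map_of M (q, f k) = Some (q, f k, Right)"
  shows "runs M q f i q f (i + d)"
  using assms
proof (induction d)
  case (Suc d)
  have "runs M q f i q f (i + d)" using Suc by simp
  also have "runs M q f (i + d) q f (i + Suc d)"
    using runs_Right[of M q f "i + d"] Suc.prems[of "i + d"] by simp
  finally show ?case .
qed (simp add: runs_refl)

lemma runs_off_marker:
  assumes "map_of M (q, 3 ^ m) = Some (q', 3 ^ m, Right)"
  shows "runs M q (tape m s) 0 q' (tape m s) 1"
proof -
  have "map_of M (q, tape m s 0) = Some (q', tape m s 0, Right)"
    using assms by (simp add: tape_def)
  then show ?thesis using runs_Right[of M q "tape m s" 0] by simp
qed

lemma runs_rewind:
  assumes "\<And>a. a \<le> 3 ^ m \<Longrightarrow> map_of M (q, a) = Some (rewind m q q' a)"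
  shows "runs M q (tape m s) i q' (tape m s) 1"
proof (induction i)
  case 0
  show ?case by (rule runs_off_marker) (use assms in \<open>simp add: rewind_def\<close>)
next
  case (Suc i)
  have "map_of M (q, tape m s (Suc i)) = Some (q, tape m s (Suc i), Left)"
    using assms by (simp add: rewind_def tape_neq_marker tape_le)
  then have "runs M q (tape m s) (Suc i) q (tape m s) i"
    using runs_Left[of M q "tape m s" i] by simp
  also note Suc
  finally show ?case .
qed

lemma runs_to_end:
  assumes "j < m" and "\<And>a. a \<le> 3 ^ m \<Longrightarrow> digit j a \<noteq> 0 \<Longrightarrow> map_of M (q, a) = Some (q, a, Right)"
  shows "runs M q (tape m s) 1 q (tape m s) (Suc (length (s j)))"
proof -
  have "map_of M (q, tape m s k) = Some (q, tape m s k, Right)" if k: "1 \<le> k" "k < 1 + length (s j)" for k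
  proof -
    obtain i where "k = Suc i" "i < length (s j)" using k by (cases k) auto
    then show ?thesis using assms by (simp add: digit_tape cell_def bit_symbol_def tape_le)
  qed
  then show ?thesis using runs_walk[of 1 "length (s j)" M q "tape m s"] by simp
qed

text \<open>The stack fills cells 1 to \<open>length (s j)\<close>, so one step back from the first
  blank reaches its top, or the marker in cell 0.\<close>

lemma runs_find_top:
  assumes "j < m" and "\<And>a. a \<le> 3 ^ m \<Longrightarrow> map_of M (q, a) = Some (find_top j q q' a)"
  shows "runs M q (tape m s) 1 q' (tape m s) (length (s j))"
proof -
  have "runs M q (tape m s) 1 q (tape m s) (Suc (length (s j)))"
    by (rule runs_to_end) (use assms in \<open>auto simp: find_top_def\<close>)
  also have "runs M q (tape m s) (Suc (length (s j))) q' (tape m s) (length (s j))"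
    using runs_Left[of M q "tape m s" "length (s j)"] assms
    by (simp add: find_top_def digit_tape cell_def tape_le)
  finally show ?thesis .
qed

text \<open>The bound on \<open>a\<close> keeps the table finite; by \<open>tape_le\<close> no
  larger symbol ever occurs.\<close>

definition contains :: "tm \<Rightarrow> nat \<Rightarrow> com \<Rightarrow> nat \<Rightarrow> bool" where
  "contains M m c q0 \<longleftrightarrow> (\<forall>q a. q0 \<le> q \<longrightarrow> q < q0 + states c \<longrightarrow> a \<le> 3 ^ m \<longrightarrow>
     map_of M (q, a) = Some (trans m c q0 q a))"

section \<open>Correctness of the compiled blocks\<close>

lemma runs_Push:
  assumes "j < m" and M: "contains M m (Push j b) q"
  shows "runs M q (tape m s) 1 (q + 2) (tape m (s(j := s j @ [b]))) 1"
proof -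
  let ?n = "length (s j)"
  have "runs M q (tape m s) 1 q (tape m s) (Suc ?n)"
    by (rule runs_to_end) (use assms in \<open>auto simp: contains_def\<close>)
  also have "runs M q (tape m s) (Suc ?n) (q + 1) (tape m (s(j := s j @ [b]))) ?n"
  proof -
    have z: "cell (s j) ?n = 0" by (simp add: cell_def)
    have "tape m (s(j := s j @ [b])) =
        (tape m s)(Suc ?n := tape m s (Suc ?n) + cell (s j @ [b]) ?n * 3 ^ j - cell (s j) ?n * 3 ^ j)"
      by (rule tape_upd) (use assms in \<open>auto simp: cell_def nth_append\<close>)
    then have "tape m (s(j := s j @ [b])) =
        (tape m s)(Suc ?n := tape m s (Suc ?n) + bit_symbol b * 3 ^ j)"
      by (simp add: cell_def)
    then show ?thesis
      using runs_Left[of M q "tape m s" ?n] assms z by (simp add: contains_def digit_tape tape_le)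
  qed
  also have "runs M (q + 1) (tape m (s(j := s j @ [b]))) ?n (q + 2) (tape m (s(j := s j @ [b]))) 1"
    by (rule runs_rewind) (use M in \<open>auto simp: contains_def\<close>)
  finally show ?thesis .
qed

lemma runs_Pop:
  assumes "j < m" and M: "contains M m (Pop j) q"
  shows "runs M q (tape m s) 1 (q + 3) (tape m (s(j := butlast (s j)))) 1"
proof -
  have "runs M q (tape m s) 1 (q + 1) (tape m s) (length (s j))"
    by (rule runs_find_top) (use assms in \<open>auto simp: contains_def\<close>)
  also have "runs M (q + 1) (tape m s) (length (s j)) (q + 3) (tape m (s(j := butlast (s j)))) 1"
  proof (cases "s j = []")
    case True
    then have "s(j := butlast (s j)) = s" by auto
    then show ?thesis using True M runs_off_marker[of M "q + 1" m "q + 3" s]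
      by (simp add: contains_def)
  next
    case False
    then obtain n where n: "length (s j) = Suc n" by (cases "s j") auto
    have "tape m (s(j := butlast (s j))) =
        (tape m s)(Suc n := tape m s (Suc n) + cell (butlast (s j)) n * 3 ^ j - cell (s j) n * 3 ^ j)"
      by (rule tape_upd) (use assms n in \<open>auto simp: cell_def nth_butlast\<close>)
    then have upd: "tape m (s(j := butlast (s j))) =
        (tape m s)(Suc n := tape m s (Suc n) - digit j (tape m s (Suc n)) * 3 ^ j)"
      using assms(1) n by (simp add: cell_def digit_tape)
    have "runs M (q + 1) (tape m s) (Suc n) (q + 2) (tape m (s(j := butlast (s j)))) n"
      unfolding upd by (rule runs_Left) (use M in \<open>auto simp: contains_def tape_neq_marker tape_le\<close>)
    also have "runs M (q + 2) (tape m (s(j := butlast (s j)))) n (q + 3) (tape m (s(j := butlast (s j)))) 1"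
      by (rule runs_rewind) (use M in \<open>auto simp: contains_def\<close>)
    finally show ?thesis by (simp add: n)
  qed
  finally show ?thesis .
qed

lemma runs_Cond:
  assumes "j < m" and M: "contains M m (Cond j c d) q"
  shows "runs M q (tape m s) 1 (if top_true (s j) then q + 4 else q + 5 + states c) (tape m s) 1"
proof -
  have "runs M q (tape m s) 1 (q + 1) (tape m s) (length (s j))"
    by (rule runs_find_top) (use assms in \<open>auto simp: contains_def\<close>)
  also have "runs M (q + 1) (tape m s) (length (s j))
      (if top_true (s j) then q + 4 else q + 5 + states c) (tape m s) 1"
  proof (cases "s j = []")
    case True
    then show ?thesis using M runs_off_marker[of M "q + 1" m "q + 5 + states c" s]
      by (simp add: contains_def top_true_def)
  next
    case False
    then obtain n where n: "length (s j) = Suc n" by (cases "s j") auto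
    have dig: "digit j (tape m s (Suc n)) = 2 \<longleftrightarrow> top_true (s j)"
      using assms(1) n False by (simp add: digit_tape cell_def bit_symbol_def top_true_def last_conv_nth)
    have "runs M (q + 1) (tape m s) (Suc n) (if top_true (s j) then q + 2 else q + 3)
        ((tape m s)(Suc n := tape m s (Suc n))) n"
      by (rule runs_Left) (use M dig in \<open>auto simp: contains_def tape_neq_marker tape_le\<close>)
    then have "runs M (q + 1) (tape m s) (Suc n) (if top_true (s j) then q + 2 else q + 3) (tape m s) n"
      by simp
    also have "runs M (if top_true (s j) then q + 2 else q + 3) (tape m s) n
        (if top_true (s j) then q + 4 else q + 5 + states c) (tape m s) 1"
      by (rule runs_rewind) (use M in \<open>auto simp: contains_def\<close>)
    finally show ?thesis by (simp add: n)
  qed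
  finally show ?thesis .
qed

text \<open>Induction on the execution instead of the program: each further round of a loop then has
  its own hypothesis about the same block.\<close>

lemma runs_exec:
  assumes "exec c s s'" and "width c \<le> m" and "contains M m c q"
  shows "runs M q (tape m s) 1 (q + states c) (tape m s') 1"
  using assms
proof (induction arbitrary: q rule: exec.induct)
  case (Push j b s)
  then show ?case using runs_Push[of j m M b q s] by (simp add: fun_upd_def)
next
  case (Pop j s)
  then show ?case using runs_Pop[of j m M q s] by (simp add: fun_upd_def)
next
  case (Seq c s s' d s'')
  have "contains M m c q" "contains M m d (q + states c)"
    using Seq.prems(2) unfolding contains_def by auto
  then have "runs M q (tape m s) 1 (q + states c) (tape m s') 1"
    "runs M (q + states c) (tape m s') 1 (q + states c + states d) (tape m s'') 1"
    using Seq by simp_all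
  then show ?case using runs_trans by (simp add: add.assoc)
next
  case (Loop_done s j c)
  have "j < m" using Loop_done.prems by simp
  then have "digit j (tape m s 1) = 0"
    using digit_tape[of j m s 0] Loop_done.hyps by (simp add: cell_def)
  then have "map_of M (q, tape m s 1) = Some (q + states (Loop j c), tape m s 1, Stay)"
    using Loop_done by (simp add: contains_def tape_le)
  then show ?case by (rule runs_Stay)
next
  case (Loop_step s j c s' s'')
  have "j < m" using Loop_step.prems by simp
  then have "digit j (tape m s 1) \<noteq> 0"
    using digit_tape[of j m s 0] Loop_step.hyps by (simp add: cell_def bit_symbol_def)
  then have "map_of M (q, tape m s 1) = Some (q + 1, tape m s 1, Stay)"
    using Loop_step by (simp add: contains_def tape_le)
  then have "runs M q (tape m s) 1 (q + 1) (tape m s) 1" by (rule runs_Stay)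
  also have "contains M m c (q + 1)"
    using Loop_step.prems(2) unfolding contains_def by auto
  then have "runs M (q + 1) (tape m s) 1 (q + 1 + states c) (tape m s') 1"
    using Loop_step.IH(1)[of "q + 1"] Loop_step.prems by simp
  also have "map_of M (q + 1 + states c, tape m s' 1) = Some (q, tape m s' 1, Stay)"
    using Loop_step.prems by (simp add: contains_def tape_le)
  then have "runs M (q + 1 + states c) (tape m s') 1 q (tape m s') 1" by (rule runs_Stay)
  also have "runs M q (tape m s') 1 (q + states (Loop j c)) (tape m s'') 1"
    using Loop_step.IH(2)[of q] Loop_step.prems by simp
  finally show ?case .
next
  case (Cond_True s j c s' d)
  have "runs M q (tape m s) 1 (q + 4) (tape m s) 1"
    using runs_Cond[of j m M c d q s] Cond_True by simp
  also have "contains M m c (q + 4)"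
    using Cond_True.prems(2) unfolding contains_def by auto
  then have "runs M (q + 4) (tape m s) 1 (q + 4 + states c) (tape m s') 1"
    using Cond_True.IH[of "q + 4"] Cond_True.prems by simp
  also have "map_of M (q + 4 + states c, tape m s' 1) = Some (q + states (Cond j c d), tape m s' 1, Stay)"
    using Cond_True.prems by (simp add: contains_def tape_le)
  then have "runs M (q + 4 + states c) (tape m s') 1 (q + states (Cond j c d)) (tape m s') 1"
    by (rule runs_Stay)
  finally show ?case .
next
  case (Cond_False s j d s' c)
  have "runs M q (tape m s) 1 (q + 5 + states c) (tape m s) 1"
    using runs_Cond[of j m M c d q s] Cond_False by simp
  also have "contains M m d (q + 5 + states c)"
    using Cond_False.prems(2) unfolding contains_def by auto
  then have "runs M (q + 5 + states c) (tape m s) 1 (q + 5 + states c + states d) (tape m s') 1"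
    using Cond_False.IH[of "q + 5 + states c"] Cond_False.prems by simp
  finally show ?case by (simp add: algebra_simps)
qed

text \<open>The input begins at the scanned cell, so states 0 and 1 step left, write the marker
  there and return; the compiled block starts at state 2.\<close>

definition startup :: "nat \<Rightarrow> com \<Rightarrow> nat \<Rightarrow> nat \<Rightarrow> nat \<times> nat \<times> dir" where
  "startup m c q a = (if q = 0 then (1, a, Left) else if q = 1 then (2, 3 ^ m, Right) else trans m c 2 q a)"

definition machine :: "com \<Rightarrow> tm" where
  "machine c = (let m = Suc (width c) in
     map (\<lambda>x. (x, startup m c (fst x) (snd x))) (List.product [0..<2 + states c] [0..<Suc (3 ^ m)]))"

lemma map_of_machine:
  "map_of (machine c) (q, a) =
    (if q < 2 + states c \<and> a \<le> 3 ^ Suc (width c) then Some (startup (Suc (width c)) c q a) else None)"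
  unfolding machine_def Let_def map_of_map_restrict restrict_map_def by auto

lemma config_at_halted:
  assumes "halted M (config_at M w n)" "n \<le> k"
  shows "config_at M w k = config_at M w n"
proof -
  have "step M cfg = cfg" if "halted M cfg" for cfg using that by (cases cfg) auto
  then have "(step M ^^ d) (config_at M w n) = config_at M w n" for d
    using assms(1) by (induction d) auto
  moreover have "config_at M w k = (step M ^^ (k - n)) (config_at M w n)"
    using assms(2) funpow_add[of "k - n" n "step M"] by (simp add: config_at_def)
  ultimately show ?thesis by simp
qed

lemma eval_tm_halted:
  assumes "halted M (config_at M w n)"
  shows "eval_tm M w = Some (tape_output (config_at M w n))"
proof -
  let ?k = "LEAST n. halted M (config_at M w n)"
  have "halted M (config_at M w ?k)" "?k \<le> n" using assms by (auto intro: LeastI Least_le)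
  then have "config_at M w n = config_at M w ?k" by (rule config_at_halted)
  then show ?thesis unfolding eval_tm_def using assms by auto
qed

text \<open>Input and output live on stack 0 and all other stacks are empty at both ends, so the
  tape right of the marker is the plain word.\<close>

theorem eval_machine:
  assumes "exec c ((\<lambda>_. [])(0 := w)) ((\<lambda>_. [])(0 := v))"
  shows "eval_tm (machine c) w = Some v"
proof -
  let ?M = "machine c" and ?m = "Suc (width c)"
  \<comment> \<open>Only track 0 is nonblank, and its weight is \<open>3 ^ 0\<close>, so the
    composite symbol is the bit symbol itself.\<close>
  have tape: "tape ?m ((\<lambda>_. [])(0 := u)) (Suc i) = cell u i" for u i
  proof -
    have "(\<lambda>j::nat. cell (((\<lambda>_. [])(0 := u)) j) i) = (\<lambda>_. 0)(0 := cell u i)"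
      by (auto simp: cell_def)
    then have "tape ?m ((\<lambda>_. [])(0 := u)) (Suc i) = symbol ?m ((\<lambda>_. 0)(0 := cell u i))"
      by (simp add: tape_def fun_upd_def)
    also have "\<dots> = cell u i" using symbol_upd[of 0 ?m "\<lambda>_. 0" "cell u i"] by (simp add: symbol_def)
    finally show ?thesis .
  qed
  define a where "a = scan (map bit_symbol w)"
  have a: "a < 3" by (cases w) (auto simp: a_def scan_def bit_symbol_def)
  have "(3::nat) \<le> 3 ^ ?m" by simp
  then have "a \<le> 3 ^ ?m" using a by linarith
  then have "step ?M (initial w) = (1, [], 0 # a # tl (map bit_symbol w))"
    unfolding initial_def by (simp add: map_of_machine startup_def flip: a_def) (simp add: scan_def)
  then have 2: "config_at ?M w 2 = (2, [3 ^ ?m], a # tl (map bit_symbol w))"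
    by (simp add: config_at_def numeral_2_eq_2 map_of_machine startup_def scan_def)
  have "represents (tape ?m ((\<lambda>_. [])(0 := w))) 1 [3 ^ ?m] (a # tl (map bit_symbol w))"
    unfolding represents_def
  proof (intro conjI allI)
    fix k
    show "tape ?m ((\<lambda>_. [])(0 := w)) (1 + k) =
        (if k < length (a # tl (map bit_symbol w)) then (a # tl (map bit_symbol w)) ! k else 0)"
      by (cases w; cases k) (auto simp: tape cell_def a_def scan_def)
  qed (simp add: tape_def)
  moreover have "runs ?M 2 (tape ?m ((\<lambda>_. [])(0 := w))) 1 (2 + states c) (tape ?m ((\<lambda>_. [])(0 := v))) 1"
    using assms by (rule runs_exec) (auto simp: contains_def map_of_machine startup_def)
  ultimately obtain n l r where
    n: "(step ?M ^^ n) (config_at ?M w 2) = (2 + states c, l, r)"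
      "represents (tape ?m ((\<lambda>_. [])(0 := v))) 1 l r"
    unfolding runs_def 2 by blast
  have cfg: "config_at ?M w (n + 2) = (2 + states c, l, r)"
    using n(1) unfolding config_at_def funpow_add by simp
  have "halted ?M (config_at ?M w (n + 2))"
    unfolding cfg by (simp add: map_of_machine)
  moreover have "tape_output (config_at ?M w (n + 2)) = v"
  proof -
    have r: "(if k < length r then r ! k else 0) = cell v k" for k
      using n(2) tape[of v k] by (simp add: represents_def)
    have len: "length v \<le> length r"
    proof (rule ccontr)
      assume "\<not> length v \<le> length r"
      then show False using r[of "length r"] by (simp add: cell_def bit_symbol_def split: if_splits)
    qed
    have "takeWhile (\<lambda>a. a \<in> {1, 2}) r = take (length v) r"
    proof (rule takeWhile_eq_take_P_nth)
      fix i assume "i < length v" "i < length r"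
      then show "r ! i \<in> {1, 2}" using r[of i] by (auto simp: cell_def bit_symbol_def)
    next
      assume "length v < length r"
      then show "r ! length v \<notin> {1, 2}" using r[of "length v"] by (simp add: cell_def)
    qed
    moreover have "map (\<lambda>a. a = 2) (take (length v) r) = v"
    proof (rule nth_equalityI)
      fix i assume "i < length (map (\<lambda>a. a = 2) (take (length v) r))"
      then have "i < length v" "i < length r" using len by auto
      then show "map (\<lambda>a. a = 2) (take (length v) r) ! i = v ! i"
        using r[of i] by (simp add: cell_def bit_symbol_def split: if_splits)
    qed (use len in simp)
    ultimately show ?thesis unfolding cfg by simp
  qed
  ultimately show ?thesis using eval_tm_halted by metis
qed

section \<open>Primitive recursive functions as stack programs\<close>

lemma exec_eqI: "exec c s t \<Longrightarrow> t = t' \<Longrightarrow> exec c s t'"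
  by simp

lemma exec_PushI: "t = s(j := s j @ [b]) \<Longrightarrow> exec (Push j b) s t"
  by (simp add: Push)

lemma exec_PopI: "t = s(j := butlast (s j)) \<Longrightarrow> exec (Pop j) s t"
  by (simp add: Pop)

text \<open>Loops are verified by giving the state \<open>t k\<close> after \<open>k\<close> rounds
  in closed form. The proof counts backwards from the final state.\<close>

lemma exec_LoopI:
  assumes "\<And>k. k < n \<Longrightarrow> t k j \<noteq> []" "\<And>k. k < n \<Longrightarrow> exec c (t k) (t (Suc k))" "t n j = []"
  shows "exec (Loop j c) (t 0) (t n)"
proof -
  have "exec (Loop j c) (t (n - d)) (t n)" if "d \<le> n" for d
    using that
  proof (induction d)
    case 0
    then show ?case using assms(3) by (simp add: Loop_done)
  next
    case (Suc d)
    define m where "m = n - Suc d"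
    have m: "n - d = Suc m" "m < n" using Suc.prems by (auto simp: m_def)
    have "exec (Loop j c) (t (Suc m)) (t n)" using Suc m by simp
    then show ?case using Loop_step[OF assms(1,2)[OF m(2)]] by (simp add: m_def)
  qed
  from this[of n] show ?thesis by simp
qed

section \<open>Unary arithmetic on stacks\<close>

definition num :: "nat \<Rightarrow> bool list" where
  "num x = replicate x True"

lemma num_0 [simp]: "num 0 = []"
  and num_eq_Nil [simp]: "num x = [] \<longleftrightarrow> x = 0"
  and num_append [simp]: "num x @ num y = num (x + y)"
  and num_snoc [simp]: "num x @ [True] = num (Suc x)"
  and butlast_num [simp]: "butlast (num x) = num (x - 1)"
  and top_true_num [simp]: "top_true (num x) \<longleftrightarrow> x > 0"
  and top_true_Nil [simp]: "\<not> top_true []"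
  by (auto simp: num_def replicate_add replicate_append_same butlast_conv_take top_true_def last_replicate)

text \<open>A stack can be read only by emptying it, so a value is preserved by producing two copies
  elsewhere.\<close>

definition dup :: "nat \<Rightarrow> nat \<Rightarrow> nat \<Rightarrow> com" where
  "dup i j k = Loop i (Seq (Pop i) (Seq (Push j True) (Push k True)))"

definition move :: "nat \<Rightarrow> nat \<Rightarrow> com" where
  "move i j = Loop i (Seq (Pop i) (Push j True))"

definition clear :: "nat \<Rightarrow> com" where
  "clear i = Loop i (Pop i)"

lemma exec_dup:
  assumes "s i = num x" "s j = num y" "s k = num z" "i \<noteq> j" "i \<noteq> k" "j \<noteq> k"
  shows "exec (dup i j k) s (s(i := [], j := num (y + x), k := num (z + x)))"
proof -
  let ?t = "\<lambda>n. s(i := num (x - n), j := num (y + n), k := num (z + n))"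
  have "exec (Loop i (Seq (Pop i) (Seq (Push j True) (Push k True)))) (?t 0) (?t x)"
    by (rule exec_LoopI; (intro exec.Seq[OF exec.Pop] exec.Seq[OF exec.Push] exec_PushI)?)
      (use assms in \<open>auto simp: fun_eq_iff\<close>)
  moreover have "?t 0 = s" using assms by auto
  ultimately show ?thesis by (simp add: dup_def)
qed

lemma exec_move:
  assumes "s i = num x" "s j = num y" "i \<noteq> j"
  shows "exec (move i j) s (s(i := [], j := num (y + x)))"
proof -
  let ?t = "\<lambda>n. s(i := num (x - n), j := num (y + n))"
  have "exec (Loop i (Seq (Pop i) (Push j True))) (?t 0) (?t x)"
    by (rule exec_LoopI; (intro exec.Seq[OF exec.Pop] exec_PushI)?)
      (use assms in \<open>auto simp: fun_eq_iff\<close>)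
  moreover have "?t 0 = s" using assms by auto
  ultimately show ?thesis by (simp add: move_def)
qed

lemma exec_clear:
  assumes "s i = num x"
  shows "exec (clear i) s (s(i := []))"
proof -
  let ?t = "\<lambda>n. s(i := num (x - n))"
  have "exec (Loop i (Pop i)) (?t 0) (?t x)"
    by (rule exec_LoopI; (intro exec_PopI)?) (auto simp: fun_eq_iff)
  moreover have "?t 0 = s" using assms by auto
  ultimately show ?thesis by (simp add: clear_def)
qed

section \<open>Cantor pairing on stacks\<close>

definition pair :: "nat \<Rightarrow> nat \<Rightarrow> nat" where
  "pair x y = prod_encode (x, y)"

definition pfst :: "nat \<Rightarrow> nat" where
  "pfst z = fst (prod_decode z)"

definition psnd :: "nat \<Rightarrow> nat" where
  "psnd z = snd (prod_decode z)"

lemma pfst_pair [simp]: "pfst (pair x y) = x"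
  and psnd_pair [simp]: "psnd (pair x y) = y"
  and pair_pfst_psnd [simp]: "pair (pfst z) (psnd z) = z"
  by (simp_all add: pair_def pfst_def psnd_def)

lemma pair_eq_iff [simp]: "pair x y = pair x' y' \<longleftrightarrow> x = x' \<and> y = y'"
  by (simp add: pair_def)

lemma pair_0 [simp]: "pair 0 0 = 0"
  by (simp add: pair_def prod_encode_def)

lemma pfst_0 [simp]: "pfst 0 = 0" and psnd_0 [simp]: "psnd 0 = 0"
  using pfst_pair[of 0 0] psnd_pair[of 0 0] by simp_all

text \<open>The next code lies one place further on the antidiagonal of pairs with constant sum or,
  when the second component is 0, at the start of the next antidiagonal.\<close>

lemma pair_Suc: "Suc z = (if psnd z = 0 then pair 0 (Suc (pfst z)) else pair (Suc (pfst z)) (psnd z - 1))"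
proof -
  obtain x y where z: "z = pair x y" by (metis pair_pfst_psnd)
  show ?thesis by (cases y) (simp_all add: z, simp_all add: pair_def prod_encode_def)
qed

lemma pfst_Suc: "pfst (Suc z) = (if psnd z = 0 then 0 else Suc (pfst z))"
  and psnd_Suc: "psnd (Suc z) = (if psnd z = 0 then Suc (pfst z) else psnd z - 1)"
  by (simp_all only: pair_Suc[of z] if_distrib[of pfst] if_distrib[of psnd] pfst_pair psnd_pair)

text \<open>Walks through the diagonal enumeration of pairs while counting down the code.\<close>

definition unpack :: "nat \<Rightarrow> com" where
  "unpack b = Seq (Loop b (Seq (Pop b) (Cond (b + 2)
       (Seq (Pop (b + 2)) (Push (b + 1) True))
       (Seq (Push (b + 1) True) (move (b + 1) (b + 2))))))
     (Seq (move (b + 1) b) (move (b + 2) (b + 1)))"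

lemma exec_unpack:
  assumes "s b = num z" "s (b + 1) = []" "s (b + 2) = []"
  shows "exec (unpack b) s (s(b := num (pfst z), b + 1 := num (psnd z)))"
proof -
  \<comment> \<open>The number of completed rounds is itself the code of the pair on stacks
    \<open>b + 1\<close> and \<open>b + 2\<close>.\<close>
  let ?t = "\<lambda>k. s(b := num (z - k), b + 1 := num (pfst k), b + 2 := num (psnd k))"
  have "exec (Loop b (Seq (Pop b) (Cond (b + 2)
       (Seq (Pop (b + 2)) (Push (b + 1) True))
       (Seq (Push (b + 1) True) (move (b + 1) (b + 2)))))) (?t 0) (?t z)" (is "exec (Loop b ?c) _ _")
  proof (rule exec_LoopI)
    fix k assume "k < z"
    let ?u = "(?t k)(b := num (z - Suc k))"
    have "exec (Cond (b + 2) (Seq (Pop (b + 2)) (Push (b + 1) True))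
       (Seq (Push (b + 1) True) (move (b + 1) (b + 2)))) ?u (?t (Suc k))"
    proof (cases "psnd k = 0")
      case True
      have "exec (Seq (Push (b + 1) True) (move (b + 1) (b + 2))) ?u (?t (Suc k))"
        by (rule exec.Seq[OF exec.Push], rule exec_eqI, rule exec_move[where x = "Suc (pfst k)" and y = 0])
          (use True in \<open>auto simp: fun_eq_iff pfst_Suc psnd_Suc\<close>)
      then show ?thesis by (intro Cond_False) (simp_all add: True top_true_def)
    next
      case False
      have "exec (Seq (Pop (b + 2)) (Push (b + 1) True)) ?u (?t (Suc k))"
        by (rule exec.Seq[OF exec.Pop], rule exec_PushI)
          (use False in \<open>auto simp: fun_eq_iff pfst_Suc psnd_Suc\<close>)
      then show ?thesis using False by (intro Cond_True) simp_all
    qed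
    then show "exec ?c (?t k) (?t (Suc k))"
      by (intro exec.Seq[OF exec_PopI[of ?u]]) (auto simp: fun_eq_iff)
  qed auto
  moreover have "?t 0 = s" using assms by auto
  ultimately have "exec (Loop b ?c) s (?t z)" by simp
  moreover have "exec (move (b + 1) b) (?t z) (s(b := num (pfst z), b + 2 := num (psnd z)))"
    by (rule exec_eqI, rule exec_move[where x = "pfst z" and y = 0]) (use assms in \<open>auto simp: fun_eq_iff\<close>)
  moreover have "exec (move (b + 2) (b + 1)) (s(b := num (pfst z), b + 2 := num (psnd z)))
      (s(b := num (pfst z), b + 1 := num (psnd z)))"
    by (rule exec_eqI, rule exec_move[where x = "psnd z" and y = 0]) (use assms in \<open>auto simp: fun_eq_iff\<close>)
  ultimately show ?thesis unfolding unpack_def by (blast intro: exec.Seq)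
qed

text \<open>Computes \<open>pair x y = triangle (x + y) + x\<close>.\<close>

definition pack :: "nat \<Rightarrow> com" where
  "pack b = Seq (dup b (b + 2) (b + 1))
     (Seq (Loop (b + 1) (Seq (dup (b + 1) (b + 2) b) (Seq (move b (b + 1)) (Pop (b + 1)))))
     (move (b + 2) b))"

lemma exec_pack:
  assumes "s b = num x" "s (b + 1) = num y" "s (b + 2) = []"
  shows "exec (pack b) s (s(b := num (pair x y), b + 1 := []))"
proof -
  \<comment> \<open>Stack \<open>b + 2\<close> starts with \<open>x\<close>; each round adds the
    current counter to it and then decreases the counter from \<open>x + y\<close> towards 0, which
    sums up to \<open>triangle (x + y)\<close>.\<close>
  define t where "t n = s(b := [], b + 1 := num (x + y - n),
    b + 2 := num (x + (triangle (x + y) - triangle (x + y - n))))" for n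
  have "exec (dup b (b + 2) (b + 1)) s (t 0)"
    by (rule exec_eqI, rule exec_dup[where x = x and y = 0 and z = y])
      (use assms in \<open>auto simp: fun_eq_iff t_def add.commute\<close>)
  moreover have "exec (Loop (b + 1) (Seq (dup (b + 1) (b + 2) b) (Seq (move b (b + 1)) (Pop (b + 1)))))
      (t 0) (t (x + y))" (is "exec (Loop _ ?c) _ _")
  proof (rule exec_LoopI)
    fix k assume k: "k < x + y"
    define r where "r = x + y - Suc k"
    have r: "x + y - k = Suc r" "x + y - Suc k = r" using k by (auto simp: r_def)
    have mono: "triangle m \<le> triangle (m + n)" for m n by (induction n) auto
    have le: "triangle r + Suc r \<le> triangle (x + y)"
      using mono[of "Suc r" k] r by (metis Suc_leI add.commute k le_add_diff_inverse less_or_eq_imp_le triangle_Suc)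
    let ?v = "num (x + (triangle (x + y) - triangle r))"
    have "exec (dup (b + 1) (b + 2) b) (t k) (s(b := num (Suc r), b + 1 := [], b + 2 := ?v))"
      by (rule exec_eqI, rule exec_dup[where x = "Suc r" and z = 0]) (use le in \<open>auto simp: t_def r fun_eq_iff intro!: arg_cong[where f = num]\<close>)
    moreover have "exec (move b (b + 1)) (s(b := num (Suc r), b + 1 := [], b + 2 := ?v))
        (s(b := [], b + 1 := num (Suc r), b + 2 := ?v))"
      by (rule exec_eqI, rule exec_move[where x = "Suc r" and y = 0]) (auto simp: fun_eq_iff)
    moreover have "exec (Pop (b + 1)) (s(b := [], b + 1 := num (Suc r), b + 2 := ?v)) (t (Suc k))"
      by (rule exec_PopI) (auto simp: fun_eq_iff t_def r)
    ultimately show "exec ?c (t k) (t (Suc k))" by (blast intro: exec.Seq)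
  qed (auto simp: t_def)
  moreover have "exec (move (b + 2) b) (t (x + y)) (s(b := num (pair x y), b + 1 := []))"
    by (rule exec_eqI, rule exec_move[where x = "pair x y" and y = 0])
      (use assms in \<open>auto simp: t_def fun_eq_iff pair_def prod_encode_def add.commute\<close>)
  ultimately show ?thesis unfolding pack_def by (blast intro: exec.Seq)
qed

definition computes :: "com \<Rightarrow> nat \<Rightarrow> (nat \<Rightarrow> nat) \<Rightarrow> bool" where
  "computes c b f \<longleftrightarrow> (\<forall>s x. s b = num x \<longrightarrow> (\<forall>j>b. s j = []) \<longrightarrow> exec c s (s(b := num (f x))))"

lemma computesD: "computes c b f \<Longrightarrow> s b = num x \<Longrightarrow> (\<And>j. j > b \<Longrightarrow> s j = []) \<Longrightarrow> exec c s (s(b := num (f x)))"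
  by (simp add: computes_def)

text \<open>The primitive recursive functions in unary form: coded pairs replace several arguments,
  and iteration replaces recursion.\<close>

inductive prim :: "(nat \<Rightarrow> nat) \<Rightarrow> bool" where
  zero: "prim (\<lambda>x. 0)"
| Suc0: "prim Suc"
| ident: "prim (\<lambda>x. x)"
| pfst0: "prim pfst"
| psnd0: "prim psnd"
| comp: "prim f \<Longrightarrow> prim g \<Longrightarrow> prim (\<lambda>x. f (g x))"
| pair: "prim f \<Longrightarrow> prim g \<Longrightarrow> prim (\<lambda>x. pair (f x) (g x))"
| iter0: "prim f \<Longrightarrow> prim (\<lambda>x. (f ^^ pfst x) (psnd x))"

lemma prim_computes: "prim f \<Longrightarrow> \<exists>c. computes c b f"
proof (induction arbitrary: b rule: prim.induct)
  case zero
  have "computes (clear b) b (\<lambda>x. 0)"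
    unfolding computes_def using exec_clear by simp
  then show ?case by blast
next
  case Suc0
  have "computes (Push b True) b Suc"
    unfolding computes_def by (auto intro!: exec_PushI)
  then show ?case by blast
next
  case ident
  have "exec (Seq (Push b True) (Pop b)) s s" for s
    by (rule exec.Seq[OF exec.Push], rule exec_PopI) (auto simp: fun_eq_iff)
  then have "computes (Seq (Push b True) (Pop b)) b (\<lambda>x. x)"
    unfolding computes_def by (metis fun_upd_triv)
  then show ?case by blast
next
  case pfst0
  have "computes (Seq (unpack b) (clear (b + 1))) b pfst"
    unfolding computes_def
  proof (intro allI impI)
    fix s x assume s: "s b = num x" "\<forall>j>b. s j = []"
    have "exec (clear (b + 1)) (s(b := num (pfst x), b + 1 := num (psnd x))) (s(b := num (pfst x)))"
      by (rule exec_eqI, rule exec_clear) (use s in \<open>auto simp: fun_eq_iff\<close>)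
    then show "exec (Seq (unpack b) (clear (b + 1))) s (s(b := num (pfst x)))"
      using exec_unpack[of s b x] s by (intro exec.Seq) auto
  qed
  then show ?case by blast
next
  case psnd0
  have "computes (Seq (unpack b) (Seq (clear b) (move (b + 1) b))) b psnd"
    unfolding computes_def
  proof (intro allI impI)
    fix s x assume s: "s b = num x" "\<forall>j>b. s j = []"
    have "exec (clear b) (s(b := num (pfst x), b + 1 := num (psnd x))) (s(b := [], b + 1 := num (psnd x)))"
      by (rule exec_eqI, rule exec_clear) (use s in \<open>auto simp: fun_eq_iff\<close>)
    moreover have "exec (move (b + 1) b) (s(b := [], b + 1 := num (psnd x))) (s(b := num (psnd x)))"
      by (rule exec_eqI, rule exec_move[where x = "psnd x" and y = 0]) (use s in \<open>auto simp: fun_eq_iff\<close>)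
    moreover have "exec (unpack b) s (s(b := num (pfst x), b + 1 := num (psnd x)))"
      using exec_unpack[of s b x] s by simp
    ultimately show "exec (Seq (unpack b) (Seq (clear b) (move (b + 1) b))) s (s(b := num (psnd x)))"
      by (blast intro: exec.Seq)
  qed
  then show ?case by blast
next
  case (comp f g)
  then obtain cf cg where c: "computes cf b f" "computes cg b g" by blast
  have "computes (Seq cg cf) b (\<lambda>x. f (g x))"
    unfolding computes_def
  proof (intro allI impI)
    fix s x assume s: "s b = num x" "\<forall>j>b. s j = []"
    have "exec cg s (s(b := num (g x)))" using computesD[OF c(2)] s by simp
    moreover have "exec cf (s(b := num (g x))) ((s(b := num (g x)))(b := num (f (g x))))"
      by (rule computesD[OF c(1)]) (use s in auto)
    ultimately show "exec (Seq cg cf) s (s(b := num (f (g x))))"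
      using exec.Seq by fastforce
  qed
  then show ?case by blast
next
  case (pair f g)
  \<comment> \<open>\<open>f\<close> is computed above a copy of the argument that waits in stack
    \<open>b + 1\<close>, hence its base \<open>b + 2\<close>.\<close>
  then obtain cf cg where c: "computes cf (b + 2) f" "computes cg (b + 1) g" by blast
  have "computes (Seq (dup b (b + 1) (b + 2)) (Seq cf (Seq (move (b + 2) b) (Seq cg (pack b))))) b
      (\<lambda>x. pair (f x) (g x))"
    unfolding computes_def
  proof (intro allI impI)
    fix s x assume s: "s b = num x" "\<forall>j>b. s j = []"
    have "exec (dup b (b + 1) (b + 2)) s (s(b := [], b + 1 := num x, b + 2 := num x))"
      by (rule exec_eqI, rule exec_dup[where x = x and y = 0 and z = 0]) (use s in auto)
    moreover have "exec cf (s(b := [], b + 1 := num x, b + 2 := num x))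
        (s(b := [], b + 1 := num x, b + 2 := num (f x)))"
      by (rule exec_eqI, rule computesD[OF c(1)]) (use s in auto)
    moreover have "exec (move (b + 2) b) (s(b := [], b + 1 := num x, b + 2 := num (f x)))
        (s(b := num (f x), b + 1 := num x))"
      by (rule exec_eqI, rule exec_move[where x = "f x" and y = 0]) (use s in \<open>auto simp: fun_eq_iff\<close>)
    moreover have "exec cg (s(b := num (f x), b + 1 := num x)) (s(b := num (f x), b + 1 := num (g x)))"
      by (rule exec_eqI, rule computesD[OF c(2)]) (use s in auto)
    moreover have "exec (pack b) (s(b := num (f x), b + 1 := num (g x))) (s(b := num (pair (f x) (g x))))"
      by (rule exec_eqI, rule exec_pack[where x = "f x" and y = "g x"]) (use s in \<open>auto simp: fun_eq_iff\<close>)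
    ultimately show "exec (Seq (dup b (b + 1) (b + 2)) (Seq cf (Seq (move (b + 2) b) (Seq cg (pack b))))) s
        (s(b := num (pair (f x) (g x))))"
      by (blast intro: exec.Seq)
  qed
  then show ?case by blast
next
  case (iter0 f)
  then obtain c where c: "computes c (b + 1) f" by blast
  have "computes (Seq (unpack b) (Seq (Loop b (Seq (Pop b) c)) (move (b + 1) b))) b
      (\<lambda>x. (f ^^ pfst x) (psnd x))"
    unfolding computes_def
  proof (intro allI impI)
    fix s x assume s: "s b = num x" "\<forall>j>b. s j = []"
    define t where "t k = s(b := num (pfst x - k), b + 1 := num ((f ^^ k) (psnd x)))" for k
    have "exec (unpack b) s (t 0)" using exec_unpack[of s b x] s by (simp add: t_def)
    moreover have "exec (Loop b (Seq (Pop b) c)) (t 0) (t (pfst x))"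
    proof (rule exec_LoopI)
      fix k assume "k < pfst x"
      have "exec c ((t k)(b := num (pfst x - Suc k))) (t (Suc k))"
        by (rule exec_eqI, rule computesD[OF c]) (use s in \<open>auto simp: t_def fun_eq_iff\<close>)
      then show "exec (Seq (Pop b) c) (t k) (t (Suc k))"
        by (intro exec.Seq[OF exec_PopI[of "(t k)(b := num (pfst x - Suc k))"]])
          (auto simp: t_def fun_eq_iff)
    qed (auto simp: t_def)
    moreover have "exec (move (b + 1) b) (t (pfst x)) (s(b := num ((f ^^ pfst x) (psnd x))))"
      by (rule exec_eqI, rule exec_move[where x = "(f ^^ pfst x) (psnd x)" and y = 0])
        (use s in \<open>auto simp: t_def fun_eq_iff\<close>)
    ultimately show "exec (Seq (unpack b) (Seq (Loop b (Seq (Pop b) c)) (move (b + 1) b))) s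
        (s(b := num ((f ^^ pfst x) (psnd x))))"
      by (blast intro: exec.Seq)
  qed
  then show ?case by blast
qed

text \<open>The one unbounded loop, going beyond primitive recursion. The state is unpacked between
  rounds, so that stack \<open>b\<close> holds its first component and acts as loop
  condition.\<close>

lemma exec_while:
  assumes f: "computes c b f" and s: "s b = num z" "\<And>j. j > b \<Longrightarrow> s j = []"
    and "\<And>k. k < n \<Longrightarrow> pfst ((f ^^ k) z) \<noteq> 0" and "pfst ((f ^^ n) z) = 0"
  shows "exec (Seq (unpack b) (Seq (Loop b (Seq (pack b) (Seq c (unpack b)))) (pack b))) s
    (s(b := num ((f ^^ n) z)))"
proof -
  define t where "t k = s(b := num (pfst ((f ^^ k) z)), b + 1 := num (psnd ((f ^^ k) z)))" for k
  have pack: "exec (pack b) (t k) (s(b := num ((f ^^ k) z)))" for k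
    by (rule exec_eqI, rule exec_pack[where x = "pfst ((f ^^ k) z)" and y = "psnd ((f ^^ k) z)"])
      (use s in \<open>auto simp: t_def fun_eq_iff\<close>)
  have unpack: "exec (unpack b) (s(b := num ((f ^^ k) z))) (t k)" for k
    by (rule exec_eqI, rule exec_unpack[where z = "(f ^^ k) z"]) (use s in \<open>auto simp: t_def fun_eq_iff\<close>)
  have "exec c (s(b := num ((f ^^ k) z))) (s(b := num ((f ^^ Suc k) z)))" for k
    by (rule exec_eqI, rule computesD[OF f]) (use s in auto)
  then have "exec (Seq (pack b) (Seq c (unpack b))) (t k) (t (Suc k))" for k
    using pack unpack by (blast intro: exec.Seq)
  then have "exec (Loop b (Seq (pack b) (Seq c (unpack b)))) (t 0) (t n)"
    by (rule exec_LoopI[rotated]) (use assms(4,5) in \<open>auto simp: t_def\<close>)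
  moreover have "s(b := num ((f ^^ 0) z)) = s" using s by auto
  then have "exec (unpack b) s (t 0)" using unpack[of 0] by simp
  ultimately show ?thesis using pack by (blast intro: exec.Seq)
qed

section \<open>Reading and writing words\<close>

abbreviation stack0 :: "bool list \<Rightarrow> stacks" where
  "stack0 w \<equiv> (\<lambda>_. [])(0 := w)"

text \<open>Popping delivers the last bit first, hence the input is folded from the right.\<close>

definition read_input :: "com \<Rightarrow> com \<Rightarrow> com" where
  "read_input c d = Seq (Loop 0 (Cond 0 (Seq (Pop 0) c) (Seq (Pop 0) d))) (move 1 0)"

lemma exec_read_input:
  assumes "computes c 1 f" "computes d 1 g"
  shows "exec (read_input c d) (stack0 w) (stack0 (num (foldr (\<lambda>b. if b then f else g) w 0)))"
proof -
  let ?h = "\<lambda>b. if b then f else g"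
  define t :: "nat \<Rightarrow> stacks" where
    "t k = (\<lambda>_. [])(0 := take (length w - k) w, 1 := num (foldr ?h (drop (length w - k) w) 0))" for k
  have "exec (Loop 0 (Cond 0 (Seq (Pop 0) c) (Seq (Pop 0) d))) (t 0) (t (length w))"
  proof (rule exec_LoopI)
    fix k assume k: "k < length w"
    define r where "r = length w - Suc k"
    have r: "length w - k = Suc r" "length w - Suc k = r" "r < length w" using k by (auto simp: r_def)
    have tk: "t k 0 = take r w @ [w ! r]" using r by (simp add: t_def take_Suc_conv_app_nth)
    have pop: "exec (Pop 0) (t k) ((t k)(0 := take r w))"
      by (rule exec_PopI) (simp add: tk)
    have step: "exec e ((t k)(0 := take r w)) (t (Suc k))" if e: "computes e 1 (?h (w ! r))" for e
      by (rule exec_eqI, rule computesD[OF e])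
        (auto simp: t_def r fun_eq_iff Cons_nth_drop_Suc[OF r(3), symmetric])
    show "exec (Cond 0 (Seq (Pop 0) c) (Seq (Pop 0) d)) (t k) (t (Suc k))"
    proof (cases "w ! r")
      case True
      then show ?thesis using pop step[of c] assms by (intro Cond_True exec.Seq) (auto simp: tk top_true_def)
    next
      case False
      then show ?thesis using pop step[of d] assms by (intro Cond_False exec.Seq) (auto simp: tk top_true_def)
    qed
  qed (auto simp: t_def)
  moreover have "t 0 = stack0 w" by (auto simp: t_def fun_eq_iff)
  moreover have "exec (move 1 0) (t (length w)) (stack0 (num (foldr ?h w 0)))"
    by (rule exec_eqI, rule exec_move[where x = "foldr ?h w 0" and y = 0]) (auto simp: t_def fun_eq_iff)
  ultimately show ?thesis unfolding read_input_def by (auto intro: exec.Seq)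
qed

text \<open>A nonempty list is coded as the successor of the pair of head and tail: each round
  removes the successor, unpacks the pair and appends the head to stack 0.\<close>

definition write_output :: com where
  "write_output = Seq (move 0 1) (Loop 1 (Seq (Pop 1) (Seq (unpack 1)
     (Seq (Cond 1 (Seq (Pop 1) (Push 0 True)) (Push 0 False)) (move 2 1)))))"

lemma exec_write_output:
  "exec write_output (stack0 (num (list_encode (map of_bool w)))) (stack0 w)"
proof -
  define t :: "nat \<Rightarrow> stacks" where
    "t k = (\<lambda>_. [])(0 := take k w, 1 := num (list_encode (map of_bool (drop k w))))" for k
  have "exec (move 0 1) (stack0 (num (list_encode (map of_bool w)))) (t 0)"
    by (rule exec_eqI, rule exec_move[where x = "list_encode (map of_bool w)" and y = 0])
      (auto simp: t_def fun_eq_iff)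
  moreover have "exec (Loop 1 (Seq (Pop 1) (Seq (unpack 1)
     (Seq (Cond 1 (Seq (Pop 1) (Push 0 True)) (Push 0 False)) (move 2 1))))) (t 0) (t (length w))"
  proof (rule exec_LoopI)
    fix k assume k: "k < length w"
    define r where "r = list_encode (map of_bool (drop (Suc k) w))"
    have drop: "list_encode (map of_bool (drop k w)) = Suc (pair (of_bool (w ! k)) r)"
      by (simp add: Cons_nth_drop_Suc[OF k, symmetric] r_def pair_def)
    show "t k 1 \<noteq> []" by (simp add: t_def drop)
    have "exec (Pop 1) (t k) ((t k)(1 := num (pair (of_bool (w ! k)) r)))"
      by (rule exec_PopI) (simp add: t_def drop)
    moreover have "exec (unpack 1) ((t k)(1 := num (pair (of_bool (w ! k)) r)))
        ((t k)(1 := num (of_bool (w ! k)), 2 := num r))"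
      by (rule exec_eqI, rule exec_unpack[where z = "pair (of_bool (w ! k)) r"]) (auto simp: t_def fun_eq_iff)
    moreover have "exec (Cond 1 (Seq (Pop 1) (Push 0 True)) (Push 0 False))
        ((t k)(1 := num (of_bool (w ! k)), 2 := num r)) ((t (Suc k))(1 := [], 2 := num r))"
    proof (cases "w ! k")
      case True
      then show ?thesis using k
        by (intro Cond_True exec.Seq[OF exec.Pop] exec_PushI)
          (auto simp: t_def fun_eq_iff take_Suc_conv_app_nth)
    next
      case False
      then show ?thesis using k
        by (intro Cond_False exec_PushI) (auto simp: t_def fun_eq_iff take_Suc_conv_app_nth)
    qed
    moreover have "exec (move 2 1) ((t (Suc k))(1 := [], 2 := num r)) (t (Suc k))"
      by (rule exec_eqI, rule exec_move[where x = r and y = 0]) (auto simp: t_def fun_eq_iff r_def)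
    ultimately show "exec (Seq (Pop 1) (Seq (unpack 1)
       (Seq (Cond 1 (Seq (Pop 1) (Push 0 True)) (Push 0 False)) (move 2 1)))) (t k) (t (Suc k))"
      by (blast intro: exec.Seq)
  qed (auto simp: t_def)
  moreover have "t (length w) = stack0 w" by (auto simp: t_def fun_eq_iff)
  ultimately show ?thesis unfolding write_output_def by (auto intro: exec.Seq)
qed

text \<open>A normal form in the style of Kleene: primitive recursive pre- and postprocessing around
  a single unbounded search.\<close>

theorem machine_of_prim:
  assumes "prim f" "prim g" "prim init" "prim next" "prim out"
  obtains V where "\<And>w n v. (\<And>k. k < n \<Longrightarrow>
        pfst ((next ^^ k) (init (foldr (\<lambda>b. if b then f else g) w 0))) \<noteq> 0) \<Longrightarrow>
      pfst ((next ^^ n) (init (foldr (\<lambda>b. if b then f else g) w 0))) = 0 \<Longrightarrow>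
      out ((next ^^ n) (init (foldr (\<lambda>b. if b then f else g) w 0))) = list_encode (map of_bool v) \<Longrightarrow>
      eval_tm V w = Some v"
proof -
  obtain cf cg ci cn co where c: "computes cf 1 f" "computes cg 1 g" "computes ci 0 init"
      "computes cn 0 next" "computes co 0 out"
    using assms prim_computes by metis
  define c where "c = Seq (read_input cf cg) (Seq ci (Seq
    (Seq (unpack 0) (Seq (Loop 0 (Seq (pack 0) (Seq cn (unpack 0)))) (pack 0))) (Seq co write_output)))"
  have "eval_tm (machine c) w = Some v"
    if "\<And>k. k < n \<Longrightarrow> pfst ((next ^^ k) (init (foldr (\<lambda>b. if b then f else g) w 0))) \<noteq> 0"
      and "pfst ((next ^^ n) (init (foldr (\<lambda>b. if b then f else g) w 0))) = 0"
      and v: "out ((next ^^ n) (init (foldr (\<lambda>b. if b then f else g) w 0))) = list_encode (map of_bool v)"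
    for w n v
  proof (rule eval_machine)
    define z where "z = foldr (\<lambda>b. if b then f else g) w 0"
    have "exec (read_input cf cg) (stack0 w) (stack0 (num z))"
      using exec_read_input[OF c(1,2)] by (simp add: z_def)
    moreover have "exec ci (stack0 (num z)) (stack0 (num (init z)))"
      by (rule exec_eqI, rule computesD[OF c(3)]) auto
    moreover have "exec (Seq (unpack 0) (Seq (Loop 0 (Seq (pack 0) (Seq cn (unpack 0)))) (pack 0)))
        (stack0 (num (init z))) (stack0 (num ((next ^^ n) (init z))))"
      by (rule exec_eqI, rule exec_while[OF c(4)]) (use that in \<open>auto simp: z_def\<close>)
    moreover have "exec co (stack0 (num ((next ^^ n) (init z)))) (stack0 (num (list_encode (map of_bool v))))"
      by (rule exec_eqI, rule computesD[OF c(5)]) (use v in \<open>auto simp: z_def\<close>)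
    ultimately show "exec c (stack0 w) (stack0 v)"
      unfolding c_def using exec_write_output by (blast intro: exec.Seq)
  qed
  then show thesis by (rule that)
qed

section \<open>Simulation of Turing machines\<close>

named_theorems prim_intros

lemma prim_ident [prim_intros]: "prim (\<lambda>x. x)"
  by (rule prim.ident)

lemma prim_Suc [prim_intros]: "prim f \<Longrightarrow> prim (\<lambda>x. Suc (f x))"
  using prim.comp[OF prim.Suc0] .

lemma prim_pfst [prim_intros]: "prim f \<Longrightarrow> prim (\<lambda>x. pfst (f x))"
  using prim.comp[OF prim.pfst0] .

lemma prim_psnd [prim_intros]: "prim f \<Longrightarrow> prim (\<lambda>x. psnd (f x))"
  using prim.comp[OF prim.psnd0] .

lemmas prim_pair [prim_intros] = prim.pair

lemma prim_const [prim_intros]: "prim (\<lambda>x. n)"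
  by (induction n) (auto intro: prim.zero prim_Suc)

text \<open>\<open>iter0\<close> admits only a fixed step function, so the parameter
  \<open>x\<close> travels along inside the iterated state.\<close>

lemma prim_iter [prim_intros]:
  assumes "prim (\<lambda>z. F (pfst z) (psnd z))" "prim n" "prim a"
  shows "prim (\<lambda>x. (F x ^^ n x) (a x))"
proof -
  define G where "G z = pair (pfst z) (F (pfst z) (psnd z))" for z
  have "(G ^^ k) (pair x y) = pair x ((F x ^^ k) y)" for k x y
    by (induction k) (simp_all add: G_def)
  moreover have "prim (\<lambda>x. psnd ((\<lambda>z. (G ^^ pfst z) (psnd z)) (pair (n x) (pair x (a x)))))"
    unfolding G_def by (intro prim_intros prim.comp[OF prim.iter0] assms)
  ultimately show ?thesis by simp
qed

lemma prim_add [prim_intros]: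
  assumes "prim f" "prim g"
  shows "prim (\<lambda>x. f x + g x)"
proof -
  have "(Suc ^^ m) n = m + n" for m n by (induction m) auto
  moreover have "prim (\<lambda>x. (Suc ^^ f x) (g x))" by (intro prim_intros assms)
  ultimately show ?thesis by simp
qed

lemma prim_diff [prim_intros]:
  assumes "prim f" "prim g"
  shows "prim (\<lambda>x. f x - g x)"
proof -
  \<comment> \<open>Iteration from 0, the code of the pair of two zeros, lets the second component
    trail the first by one.\<close>
  define pred where "pred n = psnd (((\<lambda>p. pair (Suc (pfst p)) (pfst p)) ^^ n) 0)" for n
  have "((\<lambda>p. pair (Suc (pfst p)) (pfst p)) ^^ n) 0 = pair n (n - 1)" for n
    by (induction n) auto
  then have pred: "pred n = n - 1" for n by (simp add: pred_def)
  have "(pred ^^ m) n = n - m" for m n by (induction m) (auto simp: pred)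
  moreover have "prim (\<lambda>x. (pred ^^ g x) (f x))"
    unfolding pred_def by (intro prim_intros assms)
  ultimately show ?thesis by simp
qed

lemma prim_mult [prim_intros]:
  assumes "prim f" "prim g"
  shows "prim (\<lambda>x. f x * g x)"
proof -
  have "((\<lambda>y. y + n) ^^ m) 0 = m * n" for m n :: nat by (induction m) auto
  moreover have "prim (\<lambda>x. ((\<lambda>y. y + g x) ^^ f x) 0)"
    by (intro prim_intros prim.comp[OF assms(2)] assms)
  ultimately show ?thesis by simp
qed

lemma prim_power2 [prim_intros]:
  assumes "prim f"
  shows "prim (\<lambda>x. 2 ^ f x)"
proof -
  have "((\<lambda>y. 2 * y) ^^ m) 1 = (2::nat) ^ m" for m by (induction m) auto
  moreover have "prim (\<lambda>x. ((\<lambda>y. 2 * y) ^^ f x) 1)" by (intro prim_intros assms)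
  ultimately show ?thesis by simp
qed

lemma prim_le [prim_intros]:
  assumes "prim f" "prim g"
  shows "prim (\<lambda>x. of_bool (f x \<le> g x))"
proof -
  have "prim (\<lambda>x. 1 - (f x - g x))" by (intro prim_intros assms)
  also have "(\<lambda>x. 1 - (f x - g x)) = (\<lambda>x. of_bool (f x \<le> g x))" by (auto simp: fun_eq_iff)
  finally show ?thesis .
qed

lemma prim_not [prim_intros]:
  assumes "prim (\<lambda>x. of_bool (P x))"
  shows "prim (\<lambda>x. of_bool (\<not> P x))"
proof -
  have "prim (\<lambda>x. 1 - of_bool (P x))" by (intro prim_intros assms)
  also have "(\<lambda>x. 1 - of_bool (P x)) = (\<lambda>x. of_bool (\<not> P x) :: nat)" by (auto simp: fun_eq_iff)
  finally show ?thesis .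
qed

lemma prim_conj [prim_intros]:
  assumes "prim (\<lambda>x. of_bool (P x))" "prim (\<lambda>x. of_bool (Q x))"
  shows "prim (\<lambda>x. of_bool (P x \<and> Q x))"
  unfolding of_bool_conj by (intro prim_intros assms)

lemma prim_disj [prim_intros]:
  assumes "prim (\<lambda>x. of_bool (P x))" "prim (\<lambda>x. of_bool (Q x))"
  shows "prim (\<lambda>x. of_bool (P x \<or> Q x))"
proof -
  have "prim (\<lambda>x. of_bool (\<not> (\<not> P x \<and> \<not> Q x)))" by (intro prim_intros assms)
  then show ?thesis by simp
qed

lemma prim_eq [prim_intros]:
  assumes "prim f" "prim g"
  shows "prim (\<lambda>x. of_bool (f x = g x))"
  unfolding eq_iff by (intro prim_intros assms)

lemma prim_if [prim_intros]:
  assumes "prim (\<lambda>x. of_bool (P x))" "prim f" "prim g"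
  shows "prim (\<lambda>x. if P x then f x else g x)"
proof -
  have "prim (\<lambda>x. of_bool (P x) * f x + of_bool (\<not> P x) * g x)" by (intro prim_intros assms)
  also have "(\<lambda>x. of_bool (P x) * f x + of_bool (\<not> P x) * g x) = (\<lambda>x. if P x then f x else g x)" by auto
  finally show ?thesis .
qed

lemma prim_sum [prim_intros]:
  assumes "prim (\<lambda>z. F (pfst z) (psnd z))" "prim n"
  shows "prim (\<lambda>x. \<Sum>i<n x. F x i)"
proof -
  have "((\<lambda>p. pair (Suc (pfst p)) (psnd p + F x (pfst p))) ^^ m) 0 = pair m (\<Sum>i<m. F x i)" for m x
    by (induction m) auto
  moreover have "prim (\<lambda>x. psnd (((\<lambda>p. pair (Suc (pfst p)) (psnd p + F x (pfst p))) ^^ n x) 0))"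
  proof (intro prim_intros assms)
    have "prim (\<lambda>z. pair (pfst z) (pfst (psnd z)))" by (intro prim_intros)
    from prim.comp[OF assms(1) this] show "prim (\<lambda>z. F (pfst z) (pfst (psnd z)))" by simp
  qed
  ultimately show ?thesis by simp
qed

text \<open>A bounded quantifier holds exactly if the number of counterexamples, a bounded sum, is
  0.\<close>

lemma prim_all_less [prim_intros]:
  assumes "prim (\<lambda>z. of_bool (P (pfst z) (psnd z)))" "prim n"
  shows "prim (\<lambda>x. of_bool (\<forall>i<n x. P x i))"
proof -
  have "prim (\<lambda>x. of_bool ((\<Sum>i<n x. of_bool (\<not> P x i)) = (0::nat)))" by (intro prim_intros assms)
  moreover have "(\<Sum>i<n x. of_bool (\<not> P x i)) = (0::nat) \<longleftrightarrow> (\<forall>i<n x. P x i)" for x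
    by (simp add: Int_def)
  ultimately show ?thesis by simp
qed

lemma prim_min [prim_intros]: "prim f \<Longrightarrow> prim g \<Longrightarrow> prim (\<lambda>x. min (f x) (g x))"
  unfolding min_def by (intro prim_intros)

lemma prim_mod2 [prim_intros]:
  assumes "prim f"
  shows "prim (\<lambda>x. f x mod 2)"
proof -
  have "((\<lambda>y. 1 - y) ^^ m) 0 = m mod 2" for m :: nat by (induction m) (auto simp: mod_Suc)
  moreover have "prim (\<lambda>x. ((\<lambda>y. 1 - y) ^^ f x) 0)" by (intro prim_intros assms)
  ultimately show ?thesis by simp
qed

lemma prim_div2 [prim_intros]:
  assumes "prim f"
  shows "prim (\<lambda>x. f x div 2)"
proof -
  have "(\<Sum>i<m. i mod 2) = m div 2" for m :: nat by (induction m) (auto, presburger)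
  moreover have "prim (\<lambda>x. \<Sum>i<f x. i mod 2)" by (intro prim_intros assms)
  ultimately show ?thesis by simp
qed

text \<open>Truncated subtraction gives the empty list head 0 and an empty tail, in agreement with
  the blanks beyond the tape lists.\<close>

definition lhd :: "nat \<Rightarrow> nat" where
  "lhd c = pfst (c - 1)"

definition ltl :: "nat \<Rightarrow> nat" where
  "ltl c = psnd (c - 1)"

definition lcons :: "nat \<Rightarrow> nat \<Rightarrow> nat" where
  "lcons a c = Suc (pair a c)"

lemma prim_list [prim_intros]:
  "prim f \<Longrightarrow> prim (\<lambda>x. lhd (f x))" "prim f \<Longrightarrow> prim (\<lambda>x. ltl (f x))"
  "prim f \<Longrightarrow> prim g \<Longrightarrow> prim (\<lambda>x. lcons (f x) (g x))"
  unfolding lhd_def ltl_def lcons_def by (intro prim_intros; assumption)+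

lemma lhd_list_encode [simp]: "lhd (list_encode r) = scan r"
  by (cases r) (auto simp: lhd_def scan_def simp flip: pair_def)

lemma lcons_list_encode [simp]: "lcons a (list_encode r) = list_encode (a # r)"
  by (simp add: lcons_def flip: pair_def)

lemma ltl_list_encode [simp]: "ltl (list_encode r) = list_encode (tl r)"
  by (cases r) (auto simp: ltl_def simp flip: pair_def)

lemma list_encode_eq_0 [simp]: "list_encode r = 0 \<longleftrightarrow> r = []"
  by (cases r) auto

text \<open>Allows a code to serve as the number of rounds for a traversal of its list.\<close>

lemma length_le_list_encode: "length r \<le> list_encode r"
proof (induction r)
  case (Cons a r)
  then show ?case using le_prod_encode_2[of "list_encode r" a] by simp
qed simp

section \<open>Codes of machines and configurations\<close>

definition dir_code :: "dir \<Rightarrow> nat" where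
  "dir_code d = (case d of Left \<Rightarrow> 0 | Right \<Rightarrow> 1 | Stay \<Rightarrow> 2)"

fun action_code :: "nat \<times> nat \<times> dir \<Rightarrow> nat" where
  "action_code (q, b, d) = pair q (pair b (dir_code d))"

fun entry_code :: "(nat \<times> nat) \<times> (nat \<times> nat \<times> dir) \<Rightarrow> nat" where
  "entry_code ((q, a), v) = pair (pair q a) (action_code v)"

definition tm_code :: "tm \<Rightarrow> nat" where
  "tm_code M = list_encode (map entry_code M)"

text \<open>The state pairs the remaining table with the result; emptying the table ends the search
  at the first hit, as for \<open>map_of\<close>. Result 0 is reserved for a missing entry.\<close>

definition search_step :: "nat \<Rightarrow> nat \<Rightarrow> nat" where
  "search_step k p = (if pfst p = 0 then p
     else if pfst (lhd (pfst p)) = k then pair 0 (Suc (psnd (lhd (pfst p))))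
     else pair (ltl (pfst p)) 0)"

definition lookup :: "nat \<Rightarrow> nat \<Rightarrow> nat" where
  "lookup m k = psnd ((search_step k ^^ m) (pair m 0))"

lemma prim_lookup [prim_intros]:
  assumes "prim f" "prim g"
  shows "prim (\<lambda>x. lookup (f x) (g x))"
  unfolding lookup_def search_step_def
  by (intro prim_intros prim.comp[OF assms(2)] assms)

lemma lookup_tm_code:
  "lookup (tm_code M) (pair q a) = (case map_of M (q, a) of None \<Rightarrow> 0 | Some v \<Rightarrow> Suc (action_code v))"
proof -
  let ?s = "search_step (pair q a)"
  have stop: "(?s ^^ n) (pair 0 v) = pair 0 v" for n v
    by (induction n) (auto simp: search_step_def)
  have "psnd ((?s ^^ n) (pair (list_encode (map entry_code M)) 0)) =
      (case map_of M (q, a) of None \<Rightarrow> 0 | Some v \<Rightarrow> Suc (action_code v))" if "length M \<le> n" for n M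
    using that
  proof (induction M arbitrary: n)
    case Nil
    then show ?case using stop[of n 0] by simp
  next
    case (Cons e M)
    obtain q' a' v where e: "e = ((q', a'), v)" by (metis surj_pair)
    obtain k where n: "n = Suc k" "length M \<le> k" using Cons.prems by (cases n) auto
    have step: "?s (pair (list_encode (map entry_code (e # M))) 0) =
       (if q = q' \<and> a = a' then pair 0 (Suc (action_code v)) else pair (list_encode (map entry_code M)) 0)"
      by (auto simp: search_step_def e scan_def simp del: list_encode.simps)
    show ?case using Cons.IH[OF n(2)] stop unfolding n(1) funpow_Suc_right comp_apply step
      by (auto simp: e)
  qed
  then show ?thesis
    unfolding lookup_def tm_code_def using length_le_list_encode[of "map entry_code M"] by simp
qed

fun config_code :: "config \<Rightarrow> nat" where
  "config_code (q, l, r) = pair q (pair (list_encode l) (list_encode r))"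

definition act :: "nat \<Rightarrow> nat \<Rightarrow> nat \<Rightarrow> nat" where
  "act v l r = pair (pfst v)
     (if psnd (psnd v) = 0 then pair (ltl l) (lcons (lhd l) (lcons (pfst (psnd v)) (ltl r)))
      else if psnd (psnd v) = 1 then pair (lcons (pfst (psnd v)) l) (ltl r)
      else pair l (lcons (pfst (psnd v)) (ltl r)))"

lemma act_code: "act (action_code (q, b, d)) (list_encode l) (list_encode r) = config_code (q, write_move b d l r)"
  by (cases d) (simp_all add: act_def dir_code_def del: list_encode.simps)

lemma prim_act [prim_intros]: "prim f \<Longrightarrow> prim g \<Longrightarrow> prim h \<Longrightarrow> prim (\<lambda>x. act (f x) (g x) (h x))"
  unfolding act_def by (intro prim_intros)

definition ulook :: "nat \<Rightarrow> nat \<Rightarrow> nat" where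
  "ulook m c = lookup m (pair (pfst c) (lhd (psnd (psnd c))))"

definition ustep :: "nat \<Rightarrow> nat \<Rightarrow> nat" where
  "ustep m c = (if ulook m c = 0 then c else act (ulook m c - 1) (pfst (psnd c)) (psnd (psnd c)))"

lemma prim_ulook [prim_intros]: "prim f \<Longrightarrow> prim g \<Longrightarrow> prim (\<lambda>x. ulook (f x) (g x))"
  unfolding ulook_def by (intro prim_intros)

lemma prim_ustep [prim_intros]: "prim f \<Longrightarrow> prim g \<Longrightarrow> prim (\<lambda>x. ustep (f x) (g x))"
  unfolding ustep_def by (intro prim_intros)

lemma ulook_code: "ulook (tm_code M) (pair q (pair (list_encode l) (list_encode r))) =
    (case map_of M (q, scan r) of None \<Rightarrow> 0 | Some v \<Rightarrow> Suc (action_code v))"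
  by (simp add: ulook_def lookup_tm_code)

lemma ustep_code: "ustep (tm_code M) (config_code c) = config_code (step M c)"
proof -
  obtain q l r where c: "c = (q, l, r)" by (metis surj_pair)
  show ?thesis
    by (auto simp: c ustep_def ulook_code act_code simp del: action_code.simps split: option.split)
qed

lemma halted_code: "ulook (tm_code M) (config_code c) = 0 \<longleftrightarrow> halted M c"
  by (cases c) (auto simp: ulook_code split: option.split)

text \<open>The start value 1 acts as a leading digit 1, which makes the value injective.\<close>

definition bval :: "bool list \<Rightarrow> nat" where
  "bval w = foldl (\<lambda>a b. 2 * a + of_bool b) 1 w"

lemma bval_Nil [simp]: "bval [] = 1"
  and bval_snoc [simp]: "bval (w @ [b]) = 2 * bval w + of_bool b"
  by (simp_all add: bval_def)

lemma bval_neq_0 [simp]: "bval w \<noteq> 0"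
  by (induction w rule: rev_induct) auto

lemma bval_less: "bval w < 2 ^ Suc (length w)"
  by (induction w rule: rev_induct) auto

lemma bval_inj: "bval v = bval w \<Longrightarrow> v = w"
proof (induction v arbitrary: w rule: rev_induct)
  case Nil
  then show ?case by (cases w rule: rev_cases) (auto simp: of_bool_def split: if_splits)
next
  case (snoc a v)
  show ?case
  proof (cases w rule: rev_cases)
    case Nil
    then show ?thesis using snoc.prems by (auto simp: of_bool_def split: if_splits)
  next
    case (snoc w' b)
    then have "2 * bval v + of_bool a = 2 * bval w' + of_bool b" using snoc.prems by simp
    then have "bval v = bval w' \<and> a = b" by (cases a; cases b) (simp_all, presburger+)
    then show ?thesis using snoc snoc.IH by auto
  qed
qed

text \<open>The time bound will be read off as \<open>bval\<close> of its binary notation. This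
  overestimates it, which is acceptable for a number of steps.\<close>

lemma le_bval_binary: "n \<le> bval (binary n)"
proof (induction n rule: less_induct)
  case (less n)
  show ?case
  proof (cases "n = 0")
    case False
    then have "binary n = binary (n div 2) @ [odd n]" by (subst binary.simps) simp
    then show ?thesis using less[of "n div 2"] False by (auto simp: of_bool_def)
  qed simp
qed

definition scan_step :: "nat \<Rightarrow> nat" where
  "scan_step p = (if lhd (pfst p) = 1 \<or> lhd (pfst p) = 2
     then pair (ltl (pfst p)) (2 * psnd p + (lhd (pfst p) - 1)) else pair 0 (psnd p))"

definition uout :: "nat \<Rightarrow> nat" where
  "uout c = psnd ((scan_step ^^ psnd (psnd c)) (pair (psnd (psnd c)) 1))"

lemma prim_uout [prim_intros]: "prim f \<Longrightarrow> prim (\<lambda>x. uout (f x))"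
  unfolding uout_def scan_step_def by (intro prim_intros)

lemma uout_code: "uout (config_code c) = bval (tape_output c)"
proof -
  obtain q l r where c: "c = (q, l, r)" by (metis surj_pair)
  have "psnd ((scan_step ^^ n) (pair (list_encode r) v)) =
      foldl (\<lambda>a b. 2 * a + of_bool b) v (map (\<lambda>a. a = 2) (takeWhile (\<lambda>a. a \<in> {1, 2}) r))"
    if "length r \<le> n" for n v
    using that
  proof (induction n arbitrary: r v)
    case (Suc n)
    have stop: "(scan_step ^^ n) (pair 0 v) = pair 0 v" for v
      by (induction n) (auto simp: scan_step_def lhd_def)
    show ?case
    proof (cases "\<exists>a r'. r = a # r' \<and> a \<in> {1, 2}")
      case True
      then obtain a r' where r: "r = a # r'" "a \<in> {1, 2}" by blast
      have "scan_step (pair (list_encode r) v) = pair (list_encode r') (2 * v + of_bool (a = 2))"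
        using r by (auto simp: scan_step_def scan_def simp del: list_encode.simps)
      then show ?thesis using Suc.IH[of r'] Suc.prems r by (simp add: funpow_Suc_right del: funpow.simps)
    next
      case False
      then have "scan r \<notin> {1, 2}" by (cases r) (auto simp: scan_def)
      then have "scan_step (pair (list_encode r) v) = pair 0 v" by (auto simp: scan_step_def)
      moreover have "takeWhile (\<lambda>a. a \<in> {1, 2}) r = []" using False by (cases r) auto
      ultimately show ?thesis using stop by (simp add: funpow_Suc_right del: funpow.simps)
    qed
  qed simp
  then show ?thesis
    using length_le_list_encode[of r] by (simp add: c uout_def bval_def)
qed

definition ubin :: "nat \<Rightarrow> nat" where
  "ubin n = psnd (((\<lambda>p. if pfst p = 0 then p
     else pair (pfst p div 2) (lcons (Suc (pfst p mod 2)) (psnd p))) ^^ n) (pair n 0))"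

lemma prim_ubin [prim_intros]: "prim f \<Longrightarrow> prim (\<lambda>x. ubin (f x))"
  unfolding ubin_def by (intro prim_intros)

lemma bit_symbol_odd: "bit_symbol (odd n) = Suc (n mod 2)"
  by (auto simp: bit_symbol_def odd_iff_mod_2_eq_one)

lemma ubin_code: "ubin n = list_encode (map bit_symbol (binary n))"
proof -
  let ?s = "\<lambda>p. if pfst p = 0 then p else pair (pfst p div 2) (lcons (Suc (pfst p mod 2)) (psnd p))"
  have "(?s ^^ k) (pair n (list_encode v)) = pair 0 (list_encode (map bit_symbol (binary n) @ v))"
    if "n \<le> k" for k v
    using that
  proof (induction k arbitrary: n v)
    case (Suc k)
    show ?case
    proof (cases "n = 0")
      case True
      have "(?s ^^ k) (pair 0 (list_encode v)) = pair 0 (list_encode v)" for k by (induction k) auto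
      from this[of "Suc k"] show ?thesis using True by (simp add: binary.simps[of 0] del: funpow.simps)
    next
      case False
      then have "binary n = binary (n div 2) @ [odd n]" by (subst binary.simps) simp
      moreover have "n div 2 \<le> k" using False Suc.prems by simp
      ultimately show ?thesis using Suc.IH[of "n div 2" "Suc (n mod 2) # v"] False
        by (simp add: funpow_Suc_right bit_symbol_odd del: funpow.simps list_encode.simps)
    qed
  qed (simp add: binary.simps[of 0])
  from this[of n "[]"] show ?thesis by (simp add: ubin_def)
qed

text \<open>The last \<open>n\<close> binary digits of \<open>X\<close>, with leading zeros: words
  of length \<open>n\<close> are enumerated by the numbers below \<open>2 ^ n\<close>.\<close>

fun word :: "nat \<Rightarrow> nat \<Rightarrow> bool list" where
  "word 0 X = []"
| "word (Suc n) X = word n (X div 2) @ [odd X]"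

lemma length_word [simp]: "length (word n X) = n"
  by (induction n arbitrary: X) auto

lemma inj_word: "word n X = word n Y \<Longrightarrow> X < 2 ^ n \<Longrightarrow> Y < 2 ^ n \<Longrightarrow> X = Y"
proof (induction n arbitrary: X Y)
  case (Suc n)
  then have "X div 2 = Y div 2" "odd X = odd Y" by auto
  then show ?case by (metis dvd_mult_div_cancel odd_two_times_div_two_succ)
qed simp

text \<open>\<open>uword\<close> codes bits as 0 and 1, as \<open>write_output\<close> expects,
  whereas \<open>upair\<close> and \<open>ubin\<close> produce tape symbols for the
  simulation.\<close>

definition uword :: "nat \<Rightarrow> nat \<Rightarrow> nat" where
  "uword n X = psnd (((\<lambda>p. pair (pfst p div 2) (lcons (pfst p mod 2) (psnd p))) ^^ n) (pair X 0))"

definition upair :: "nat \<Rightarrow> nat \<Rightarrow> nat \<Rightarrow> nat" where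
  "upair n X v = psnd (((\<lambda>p. pair (pfst p div 2)
     (lcons (Suc (pfst p mod 2)) (lcons (Suc (pfst p mod 2)) (psnd p)))) ^^ n) (pair X v))"

lemma prim_uword [prim_intros]: "prim f \<Longrightarrow> prim g \<Longrightarrow> prim (\<lambda>x. uword (f x) (g x))"
  unfolding uword_def by (intro prim_intros)

lemma prim_upair [prim_intros]: "prim f \<Longrightarrow> prim g \<Longrightarrow> prim h \<Longrightarrow> prim (\<lambda>x. upair (f x) (g x) (h x))"
  unfolding upair_def by (intro prim_intros)

lemma uword_code: "uword n X = list_encode (map of_bool (word n X))"
proof -
  let ?s = "\<lambda>p. pair (pfst p div 2) (lcons (pfst p mod 2) (psnd p))"
  have "psnd ((?s ^^ n) (pair X (list_encode v))) = list_encode (map of_bool (word n X) @ v)" for v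
    by (induction n arbitrary: X v)
      (simp_all add: funpow_Suc_right mod_2_eq_odd del: funpow.simps list_encode.simps)
  from this[of "[]"] show ?thesis by (simp add: uword_def)
qed

lemma upair_code: "upair n X (list_encode v) =
    list_encode (map bit_symbol (concat (map (\<lambda>b. [b, b]) (word n X))) @ v)"
  unfolding upair_def
  by (induction n arbitrary: X v)
    (simp_all add: funpow_Suc_right bit_symbol_odd del: funpow.simps list_encode.simps)

definition urun :: "nat \<Rightarrow> nat \<Rightarrow> nat \<Rightarrow> nat" where
  "urun m w n = (ustep m ^^ n) (pair 0 (pair 0 w))"

lemma prim_urun [prim_intros]:
  assumes "prim f" "prim g" "prim h"
  shows "prim (\<lambda>x. urun (f x) (g x) (h x))"
  unfolding urun_def by (intro prim_intros prim.comp[OF assms(1)] assms)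

lemma urun_code: "urun (tm_code M) (list_encode (map bit_symbol w)) n = config_code (config_at M w n)"
proof -
  have "pair 0 (pair 0 (list_encode (map bit_symbol w))) = config_code (initial w)"
    by (simp add: initial_def)
  then show ?thesis unfolding urun_def config_at_def by (induction n) (simp_all add: ustep_code)
qed

section \<open>The selecting machine and the counting argument\<close>

text \<open>
  The parameters are all read off from a single number \<open>k = pair j (pair A T)\<close>: the window length
  \<open>j\<close> and the codes of the algorithm \<open>A\<close> and of a machine \<open>T\<close> for the time bound.
\<close>

definition word_length :: "nat \<Rightarrow> nat" where
  "word_length k = 4 * pfst k * k"

text \<open>Exceeds \<open>bval\<close> of every word of length at most \<open>3 * k\<close>, so
  such outputs survive the truncation.\<close>

definition cap :: "nat \<Rightarrow> nat" where
  "cap k = 2 ^ (3 * k + 1)"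

text \<open>Symbols 1 and 2 are the separator of \<open>pair_code\<close>. The value is the code of
  the whole configuration after \<open>t\<close> steps.\<close>

definition answer :: "nat \<Rightarrow> nat \<Rightarrow> nat \<Rightarrow> nat \<Rightarrow> nat" where
  "answer k t X l = urun (pfst (psnd k)) (upair (word_length k) X (lcons 1 (lcons 2 (ubin l)))) t"

text \<open>The value 0 marks a run that has not halted; it is never a \<open>bval\<close>.\<close>

definition signature :: "nat \<Rightarrow> nat \<Rightarrow> nat \<Rightarrow> nat \<Rightarrow> nat" where
  "signature k t X l =
    (if ulook (pfst (psnd k)) (answer k t X l) = 0 then min (uout (answer k t X l)) (cap k) else 0)"

definition same :: "nat \<Rightarrow> nat \<Rightarrow> nat \<Rightarrow> nat \<Rightarrow> bool" where
  "same k t X Y \<longleftrightarrow> (\<forall>i<pfst k. signature k t X (k - 1 + i) = signature k t Y (k - 1 + i))"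

definition large :: "nat \<Rightarrow> nat \<Rightarrow> nat \<Rightarrow> bool" where
  "large k t X \<longleftrightarrow> 2 ^ k \<le> (\<Sum>Y<2 ^ word_length k. of_bool (same k t Y X) :: nat)"

text \<open>
  The least \<open>X\<close> with a property that is inherited upwards equals the number of those without it;
  \<open>leader\<close> and \<open>select\<close> are least elements expressed in this way.
\<close>

definition leader :: "nat \<Rightarrow> nat \<Rightarrow> nat" where
  "leader k t = (\<Sum>X<2 ^ word_length k. of_bool (\<forall>Y<Suc X. \<not> large k t Y))"

text \<open>\<open>X\<close> itself is counted, so the class member with \<open>i\<close>
  predecessors is the least \<open>X\<close> of rank above \<open>i\<close>.\<close>

definition rank :: "nat \<Rightarrow> nat \<Rightarrow> nat \<Rightarrow> nat" where
  "rank k t X = (\<Sum>Y<Suc X. of_bool (same k t Y (leader k t)))"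

definition select :: "nat \<Rightarrow> nat \<Rightarrow> nat \<Rightarrow> nat" where
  "select k t i = (\<Sum>X<2 ^ word_length k. of_bool (rank k t X \<le> i))"

section \<open>Primitive recursiveness of the selection\<close>

lemma prim_word_length [prim_intros]: "prim f \<Longrightarrow> prim (\<lambda>x. word_length (f x))"
  unfolding word_length_def by (intro prim_intros)

lemma prim_answer [prim_intros]:
  "prim f \<Longrightarrow> prim g \<Longrightarrow> prim h \<Longrightarrow> prim i \<Longrightarrow> prim (\<lambda>x. answer (f x) (g x) (h x) (i x))"
  unfolding answer_def by (intro prim_intros)

lemma prim_signature [prim_intros]:
  "prim f \<Longrightarrow> prim g \<Longrightarrow> prim h \<Longrightarrow> prim i \<Longrightarrow> prim (\<lambda>x. signature (f x) (g x) (h x) (i x))"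
  unfolding signature_def cap_def by (intro prim_intros)

lemma prim_same [prim_intros]:
  assumes "prim f" "prim g" "prim h" "prim i"
  shows "prim (\<lambda>x. of_bool (same (f x) (g x) (h x) (i x)))"
  unfolding same_def by (intro prim_intros assms assms[THEN prim.comp])

lemma prim_large [prim_intros]:
  assumes "prim f" "prim g" "prim h"
  shows "prim (\<lambda>x. of_bool (large (f x) (g x) (h x)))"
  unfolding large_def by (intro prim_intros assms assms[THEN prim.comp])

lemma prim_leader [prim_intros]:
  assumes "prim f" "prim g"
  shows "prim (\<lambda>x. leader (f x) (g x))"
  unfolding leader_def by (intro prim_intros assms assms[THEN prim.comp])

lemma prim_rank [prim_intros]:
  assumes "prim f" "prim g" "prim h"
  shows "prim (\<lambda>x. rank (f x) (g x) (h x))"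
  unfolding rank_def by (intro prim_intros assms assms[THEN prim.comp])

lemma prim_select [prim_intros]:
  assumes "prim f" "prim g" "prim h"
  shows "prim (\<lambda>x. select (f x) (g x) (h x))"
  unfolding select_def by (intro prim_intros assms assms[THEN prim.comp])

text \<open>The numbers without the property form the initial segment below the least one with it.
  Thus \<open>prim_sum\<close> covers bounded minimisation.\<close>

lemma count_eq_Least:
  fixes N :: nat
  assumes "\<exists>X<N. Q X" and "\<And>X Y. Q X \<Longrightarrow> X \<le> Y \<Longrightarrow> Q Y"
  shows "(\<Sum>X<N. of_bool (\<not> Q X)) = (LEAST X. Q X)"
proof -
  obtain X where X: "X < N" "Q X" using assms(1) by blast
  define L where "L = (LEAST X. Q X)"
  have L: "Q L" "L \<le> X" using X(2) by (auto simp: L_def intro: LeastI Least_le)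
  have "Y < N \<and> \<not> Q Y \<longleftrightarrow> Y < L" for Y
    using assms(2)[OF L(1), of Y] not_less_Least[of Y Q] L(2) X(1) unfolding L_def by linarith
  then have "{..<N} \<inter> {X. \<not> Q X} = {..<L}" by blast
  moreover have "(\<Sum>X<N. of_bool (\<not> Q X)) = card ({..<N} \<inter> {X. \<not> Q X})"
    by simp
  ultimately show ?thesis unfolding L_def[symmetric] by (simp only: card_lessThan)
qed

lemma large_leader:
  assumes "\<exists>X<2 ^ word_length k. large k t X"
  shows "large k t (leader k t)"
proof -
  \<comment> \<open>\<open>large\<close> need not be inherited upwards, but the existence of a large
    number up to \<open>X\<close> is.\<close>
  let ?Q = "\<lambda>X. \<exists>Y<Suc X. large k t Y"
  have leader: "leader k t = (LEAST X. ?Q X)"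
  proof -
    have "\<exists>X<2 ^ word_length k. ?Q X" using assms by blast
    moreover have "?Q Y" if "?Q X" "X \<le> Y" for X Y using that by (meson Suc_le_mono less_le_trans)
    ultimately have "(\<Sum>X<2 ^ word_length k. of_bool (\<not> ?Q X)) = (LEAST X. ?Q X)"
      by (rule count_eq_Least)
    then show ?thesis by (simp add: leader_def)
  qed
  have "?Q (leader k t)" unfolding leader by (rule LeastI_ex) (use assms in blast)
  then obtain Y where Y: "Y \<le> leader k t" "large k t Y" by (auto simp: less_Suc_eq_le)
  moreover have "leader k t \<le> Y" unfolding leader using Y by (intro Least_le) auto
  ultimately show ?thesis by simp
qed

lemma rank_mono: "X \<le> Y \<Longrightarrow> rank k t X \<le> rank k t Y"
  unfolding rank_def by (rule sum_mono2) auto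

lemma select_leader:
  assumes "\<exists>X<2 ^ word_length k. large k t X" "i < 2 ^ k"
  shows "select k t i < 2 ^ word_length k" "same k t (select k t i) (leader k t)"
    "rank k t (select k t i) = Suc i"
proof -
  let ?N = "2 ^ word_length k :: nat"
  have N: "Suc (?N - 1) = ?N" by simp
  have "i < rank k t (?N - 1)"
    unfolding rank_def N using large_leader[OF assms(1)] assms(2) unfolding large_def by linarith
  then have ex: "\<exists>X<?N. i < rank k t X" using N by (metis lessI)
  have sel: "select k t i = (LEAST X. i < rank k t X)"
  proof -
    have "i < rank k t Y" if "i < rank k t X" "X \<le> Y" for X Y using that rank_mono less_le_trans by blast
    with ex have "(\<Sum>X<?N. of_bool (\<not> i < rank k t X)) = (LEAST X. i < rank k t X)"
      by (rule count_eq_Least)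
    then show ?thesis by (simp add: select_def not_less)
  qed
  have gt: "i < rank k t (select k t i)" unfolding sel using ex by (metis LeastI)
  have le: "(\<Sum>Y<select k t i. of_bool (same k t Y (leader k t))) \<le> i"
  proof (cases "select k t i")
    case (Suc X)
    then have "\<not> i < rank k t X" using not_less_Least[of X "\<lambda>X. i < rank k t X"] sel by simp
    then show ?thesis by (simp add: Suc rank_def)
  qed simp
  \<comment> \<open>At most \<open>i\<close> members lie strictly below the selected number while
    its rank exceeds \<open>i\<close>, so it is itself a member and its rank is exactly
    \<open>Suc i\<close>.\<close>
  have "rank k t (select k t i) =
      (\<Sum>Y<select k t i. of_bool (same k t Y (leader k t))) + of_bool (same k t (select k t i) (leader k t))"
    unfolding rank_def by (rule sum.lessThan_Suc)
  then show "same k t (select k t i) (leader k t)" "rank k t (select k t i) = Suc i"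
    using gt le by (auto simp: of_bool_def split: if_splits)
  show "select k t i < ?N" unfolding sel using ex by (meson Least_le le_less_trans)
qed

lemma signature_le: "signature k t X l \<le> cap k"
  by (simp add: signature_def)

text \<open>Pigeonhole: if every class of equal signature vectors had fewer than
  \<open>2 ^ k\<close> members, the classes together could not cover all words of the given
  length.\<close>

lemma ex_large:
  assumes "pfst k * (3 * k + 2) + k \<le> word_length k"
  shows "\<exists>X<2 ^ word_length k. large k t X"
proof (rule ccontr)
  assume no: "\<not> ?thesis"
  let ?N = "2 ^ word_length k :: nat"
  define v where "v X = map (\<lambda>i. signature k t X (k - 1 + i)) [0..<pfst k]" for X
  define B where "B = {xs. set xs \<subseteq> {..<2 ^ (3 * k + 2) :: nat} \<and> length xs = pfst k}"
  have B: "finite B" "card B = 2 ^ (pfst k * (3 * k + 2))"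
    unfolding B_def
    by (simp add: finite_lists_length_eq)
      (simp only: card_lists_length_eq finite_lessThan card_lessThan mult.commute[of "pfst k"] power_mult)
  \<comment> \<open>Signatures range from 0 to \<open>cap k\<close> inclusive, so the exponent is
    rounded up by one.\<close>
  have "cap k < 2 ^ (3 * k + 2)" unfolding cap_def by (rule power_strict_increasing) auto
  then have "signature k t X l < 2 ^ (3 * k + 2)" for X l
    using signature_le le_less_trans by blast
  then have image: "v ` {..<?N} \<subseteq> B" by (auto simp: v_def B_def)
  have fibre: "card {Y \<in> {..<?N}. v Y = y} \<le> 2 ^ k - 1" if "y \<in> v ` {..<?N}" for y
  proof -
    obtain X where X: "X < ?N" "y = v X" using \<open>y \<in> _\<close> by auto
    have "v Y = v X \<longleftrightarrow> same k t Y X" for Y by (auto simp: v_def same_def)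
    then have "{Y \<in> {..<?N}. v Y = y} = {..<?N} \<inter> {Y. same k t Y X}" using X by auto
    then have "card {Y \<in> {..<?N}. v Y = y} = (\<Sum>Y<?N. of_bool (same k t Y X))"
      by simp
    moreover have "\<not> large k t X" using no X by blast
    ultimately show ?thesis unfolding large_def by linarith
  qed
  have "?N = card {..<?N}" by simp
  also have "\<dots> = (\<Sum>y\<in>v ` {..<?N}. card {Y \<in> {..<?N}. v Y = y})"
    using sum.image_gen[of "{..<?N}" "\<lambda>_. 1::nat" v] by simp
  also have "\<dots> \<le> card (v ` {..<?N}) * (2 ^ k - 1)"
    using sum_bounded_above[of "v ` {..<?N}" "\<lambda>y. card {Y \<in> {..<?N}. v Y = y}" "2 ^ k - 1"] fibre by simp
  also have "\<dots> \<le> 2 ^ (pfst k * (3 * k + 2)) * (2 ^ k - 1)"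
    using card_mono[OF B(1) image] B(2) by (intro mult_right_mono) auto
  also have "\<dots> < 2 ^ (pfst k * (3 * k + 2)) * 2 ^ k" by simp
  also have "\<dots> \<le> ?N" unfolding power_add[symmetric] using assms by (rule power_increasing) simp
  finally show False by simp
qed

text \<open>Least significant bit first, so that the right fold over the input computes it along
  with the length.\<close>

fun index :: "bool list \<Rightarrow> nat" where
  "index [] = 0"
| "index (b # p) = 2 * index p + of_bool b"

lemma index_less: "index p < 2 ^ length p"
  by (induction p) auto

lemma index_inj: "length p = length q \<Longrightarrow> index p = index q \<Longrightarrow> p = q"
proof (induction p q rule: list_induct2)
  case (Cons a p b q)
  then have "2 * index p + of_bool a = 2 * index q + of_bool b" by simp
  then have "index p = index q \<and> a = b" by (cases a; cases b) (simp_all, presburger+)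
  then show ?case using Cons by simp
qed simp

section \<open>The universal selecting machine\<close>

definition time_run :: "nat \<Rightarrow> nat \<Rightarrow> nat" where
  "time_run k s = urun (psnd (psnd k)) (ubin (word_length k)) s"

text \<open>The state consists of a flag, the pair of \<open>k\<close> and the index, and a step
  number; the flag drops to 0 when the time machine is found halted.\<close>

definition search :: "nat \<Rightarrow> nat" where
  "search z = (if ulook (psnd (psnd (pfst (pfst (psnd z))))) (time_run (pfst (pfst (psnd z))) (psnd (psnd z))) = 0
     then pair 0 (psnd z) else pair 1 (pair (pfst (psnd z)) (Suc (psnd (psnd z)))))"

definition found :: "nat \<Rightarrow> nat" where
  "found z = uword (word_length (pfst (pfst (psnd z))))
     (select (pfst (pfst (psnd z))) (uout (time_run (pfst (pfst (psnd z))) (psnd (psnd z)))) (psnd (pfst (psnd z))))"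

text \<open>\<open>V\<close> learns \<open>k\<close>, and with it all parameters, from the length of
  its input. It waits for \<open>T\<close> to halt and uses \<open>bval\<close> of the output as
  step bound.\<close>

lemma universal_selector:
  "\<exists>V. \<forall>k j A T u p. k = pair j (pair A (tm_code T)) \<longrightarrow> length p = k \<longrightarrow>
    eval_tm T (binary (word_length k)) = Some (binary u) \<longrightarrow>
    eval_tm V p = Some (word (word_length k) (select k (bval (binary u)) (index p)))"
proof -
  let ?f = "\<lambda>z. pair (Suc (pfst z)) (Suc (2 * psnd z))" and ?g = "\<lambda>z. pair (Suc (pfst z)) (2 * psnd z)"
  have fold: "foldr (\<lambda>b. if b then ?f else ?g) p 0 = pair (length p) (index p)" for p
    by (induction p) auto
  have prim: "prim ?f" "prim ?g" "prim (\<lambda>z. pair 1 (pair z 0))" "prim search" "prim found"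
    unfolding search_def[abs_def] found_def[abs_def] time_run_def by (intro prim_intros)+
  show ?thesis
  proof (rule machine_of_prim[OF prim, unfolded fold])
    fix V assume V: "\<And>w n v.
        (\<And>k. k < n \<Longrightarrow> pfst ((search ^^ k) (pair 1 (pair (pair (length w) (index w)) 0))) \<noteq> 0) \<Longrightarrow>
        pfst ((search ^^ n) (pair 1 (pair (pair (length w) (index w)) 0))) = 0 \<Longrightarrow>
        found ((search ^^ n) (pair 1 (pair (pair (length w) (index w)) 0))) = list_encode (map of_bool v) \<Longrightarrow>
        eval_tm V w = Some v"
    have "eval_tm V p = Some (word (word_length k) (select k (bval (binary u)) (index p)))"
      if k: "k = pair j (pair A (tm_code T))" "length p = k"
        and T: "eval_tm T (binary (word_length k)) = Some (binary u)" for k j A T u p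
    proof -
      let ?cfg = "config_at T (binary (word_length k))"
      define s where "s = (LEAST n. halted T (?cfg n))"
      have ex: "\<exists>n. halted T (?cfg n)" using T by (auto simp: eval_tm_def split: if_splits)
      then have s: "halted T (?cfg s)" "\<And>n. n < s \<Longrightarrow> \<not> halted T (?cfg n)"
        unfolding s_def by (auto intro: LeastI_ex dest: not_less_Least)
      have u: "tape_output (?cfg s) = binary u"
        using T ex by (auto simp: eval_tm_def s_def)
      have run: "time_run k n = config_code (?cfg n)" for n
        by (simp add: time_run_def k(1) ubin_code urun_code)
      let ?z = "pair k (index p)"
      have search: "search (pair 1 (pair ?z n)) =
          (if halted T (?cfg n) then pair 0 (pair ?z n) else pair 1 (pair ?z (Suc n)))" for n
        using run[of n] halted_code[of T "?cfg n"] k(1) by (simp add: search_def)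
      have iter: "(search ^^ n) (pair 1 (pair ?z 0)) = pair 1 (pair ?z n)" if "n \<le> s" for n
        using that by (induction n) (auto simp: search[unfolded One_nat_def] s(2))
      have stop: "(search ^^ Suc s) (pair 1 (pair ?z 0)) = pair 0 (pair ?z s)"
        using iter[of s] s(1) by (simp add: search[unfolded One_nat_def])
      show ?thesis
      proof (rule V[of "Suc s"])
        fix n assume "n < Suc s"
        then show "pfst ((search ^^ n) (pair 1 (pair (pair (length p) (index p)) 0))) \<noteq> 0"
          unfolding k(2) using iter[of n] by simp
      next
        show "pfst ((search ^^ Suc s) (pair 1 (pair (pair (length p) (index p)) 0))) = 0"
          unfolding k(2) stop by simp
        show "found ((search ^^ Suc s) (pair 1 (pair (pair (length p) (index p)) 0))) =
            list_encode (map of_bool (word (word_length k) (select k (bval (binary u)) (index p))))"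
          unfolding k(2) stop by (simp add: found_def run uout_code u uword_code)
      qed
    qed
    then show ?thesis by blast
  qed
qed

text \<open>Running longer than needed is harmless because halted configurations persist, and a
  short output stays below the cap.\<close>

lemma signature_eq_bval:
  assumes k: "k = pair j (pair (tm_code A) T)"
    and q: "outputs_within A (pair_code (word (word_length k) X) (binary l)) t q" "length q \<le> 3 * k"
    and "t \<le> t'"
  shows "signature k t' X l = bval q"
proof -
  let ?w = "pair_code (word (word_length k) X) (binary l)"
  have "config_at A ?w t' = config_at A ?w t"
    using q(1) assms(4) by (intro config_at_halted) (auto simp: outputs_within_def)
  then have h: "halted A (config_at A ?w t')" "tape_output (config_at A ?w t') = q"
    using q(1) by (auto simp: outputs_within_def)
  have "lcons 1 (lcons 2 (ubin l)) = list_encode (map bit_symbol ([False, True] @ binary l))"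
    unfolding ubin_code by (simp add: bit_symbol_def del: list_encode.simps)
  then have "upair (word_length k) X (lcons 1 (lcons 2 (ubin l))) = list_encode (map bit_symbol ?w)"
    by (simp add: upair_code pair_code_def del: list_encode.simps list.map)
  then have ans: "answer k t' X l = config_code (config_at A ?w t')"
    using k by (simp add: answer_def urun_code)
  have "bval q < 2 ^ Suc (length q)" by (rule bval_less)
  also have "\<dots> \<le> cap k" unfolding cap_def using q(2) by (intro power_increasing) auto
  finally have "min (bval q) (cap k) = bval q" by simp
  moreover have "ulook (pfst (psnd k)) (answer k t' X l) = 0"
    using h(1) halted_code k unfolding ans by simp
  ultimately show ?thesis unfolding signature_def using h(2) by (simp add: ans uout_code)
qed

section \<open>Collision of two words of equal complexity\<close>

theorem lemma6p2:
  fixes U :: tm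
  assumes "standard U"
  shows "\<exists>e::real. e > 0 \<and>
    \<not> (\<exists>(t :: nat \<Rightarrow> nat) (A :: tm). computable_nat t \<and>
         (\<forall>x. \<exists>p. outputs_within A (pair_code x (binary (plain_complexity U x))) (t (length x)) p
                \<and> short_program U (real (length x) / e) x p))"
proof -
  obtain V where V: "\<And>k j A T u p. k = pair j (pair A (tm_code T)) \<Longrightarrow> length p = k \<Longrightarrow>
    eval_tm T (binary (word_length k)) = Some (binary u) \<Longrightarrow>
    eval_tm V p = Some (word (word_length k) (select k (bval (binary u)) (index p)))"
    using universal_selector by blast
  obtain \<tau> d where \<tau>: "\<And>p. eval_tm U (\<tau> p) = eval_tm V p"
    and d: "\<And>p. \<bar>int (length (\<tau> p)) - int (length p)\<bar> \<le> d"
    using assms unfolding standard_def by meson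
  define c where "c = nat d"
  have c: "length (\<tau> p) \<le> length p + c" for p using d[of p] by (simp add: c_def)
  \<comment> \<open>\<open>c\<close> depends only on \<open>U\<close> and \<open>V\<close>, so
    \<open>j\<close> is fixed before \<open>t\<close> and \<open>A\<close>. The window must cover
    the \<open>c + 2\<close> values from \<open>k - 1\<close> to \<open>k + c\<close>, and
    \<open>3 \<le> j\<close> enters the size estimate for \<open>n\<close>.\<close>
  define j where "j = c + 3"
  have False if t: "computable_nat t"
    and A: "\<And>x. \<exists>p. outputs_within A (pair_code x (binary (plain_complexity U x))) (t (length x)) p
                \<and> short_program U (real (length x) / (4 * real j)) x p" for t A
  proof -
    obtain T where T: "\<And>n. eval_tm T (binary n) = Some (binary (t n))"
      using t unfolding computable_nat_def by blast
    define k where "k = pair j (pair (tm_code A) (tm_code T))"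
    define n where "n = word_length k"
    have n: "n = 4 * j * k" by (simp add: n_def word_length_def k_def)
    \<comment> \<open>A pair code is at least its first component; so \<open>k\<close> exceeds
      \<open>c\<close>, which drives the final contradiction.\<close>
    have "j \<le> k" unfolding k_def pair_def by (rule le_prod_encode_1)
    define t' where "t' = bval (binary (t n))"
    have t': "t n \<le> t'" unfolding t'_def by (rule le_bval_binary)
    define X where "X p = select k t' (index p)" for p
    define x where "x p = word n (X p)" for p
    define C where "C p = plain_complexity U (x p)" for p
    let ?P = "{p :: bool list. length p = k}"
    have P: "finite ?P" "card ?P = 2 ^ k"
      using finite_lists_length_eq[of "UNIV :: bool set" k] card_lists_length_eq[of "UNIV :: bool set" k]
      by simp_all
    have "j * (3 * k + 2) + k \<le> n"
    proof -
      have "2 * j + k \<le> j * k"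
      proof -
        have "3 \<le> j" by (simp add: j_def)
        then have "3 * k \<le> j * k" "j * 3 \<le> j * k" using \<open>j \<le> k\<close> by simp_all
        moreover have "j * k + j * k = 2 * (j * k)" by simp
        ultimately show ?thesis using \<open>j \<le> k\<close> by linarith
      qed
      then show ?thesis by (simp add: n algebra_simps)
    qed
    then have large: "\<exists>X<2 ^ word_length k. large k t' X"
      by (intro ex_large) (simp add: n_def k_def)
    have X: "X p < 2 ^ n" "same k t' (X p) (leader k t')" "rank k t' (X p) = Suc (index p)" if "p \<in> ?P" for p
      using select_leader[OF large, of "index p"] index_less[of p] that by (auto simp: X_def n_def)
    have inj_x: "inj_on x ?P"
    proof (rule inj_onI)
      fix p q assume pq: "p \<in> ?P" "q \<in> ?P" "x p = x q"
      then have "X p = X q" using X(1) inj_word by (simp add: x_def)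
      then have "index p = index q" using X(3) pq by (metis nat.inject)
      then show "p = q" using pq index_inj by simp
    qed
    have prog: "eval_tm U (\<tau> p) = Some (x p)" if "p \<in> ?P" for p
      using V[OF k_def, of p "t n"] T that by (simp add: \<tau> x_def X_def n_def t'_def)
    have C_le: "C p \<le> k + c" if "p \<in> ?P" for p
    proof -
      have "C p \<le> length (\<tau> p)"
        unfolding C_def plain_complexity_def using prog[OF that] by (intro Least_le) blast
      also have "\<dots> \<le> k + c" using c[of p] that by simp
      finally show ?thesis .
    qed
    have "\<exists>q. eval_tm U q = Some (x p) \<and> length q = C p" if "p \<in> ?P" for p
      unfolding C_def plain_complexity_def
      by (rule LeastI_ex[of "\<lambda>n. \<exists>q. eval_tm U q = Some (x p) \<and> length q = n"]) (use prog[OF that] in blast)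
    then obtain m where m: "\<And>p. p \<in> ?P \<Longrightarrow> eval_tm U (m p) = Some (x p) \<and> length (m p) = C p"
      by metis
    let ?D = "{p \<in> ?P. C p < k - 1}"
    \<comment> \<open>Distinct words have distinct shortest programs, and those for
      \<open>?D\<close> have length at most \<open>k - 2\<close>; hence \<open>?D\<close> is at most
      half of \<open>?P\<close>.\<close>
    have "inj_on (bval \<circ> m) ?D"
      using m inj_x bval_inj by (intro inj_onI) (metis (no_types, lifting) comp_apply inj_onD mem_Collect_eq option.inject)
    moreover have "(bval \<circ> m) ` ?D \<subseteq> {..<2 ^ (k - 1)}"
    proof (rule image_subsetI)
      fix p assume "p \<in> ?D"
      then have "Suc (length (m p)) \<le> k - 1" using m[of p] by simp
      then have "(2::nat) ^ Suc (length (m p)) \<le> 2 ^ (k - 1)" by (intro power_increasing) auto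
      then show "(bval \<circ> m) p \<in> {..<2 ^ (k - 1)}" using bval_less[of "m p"] by simp
    qed
    ultimately have D: "card ?D \<le> 2 ^ (k - 1)"
      using card_inj_on_le[of "bval \<circ> m" ?D "{..<2 ^ (k - 1)}"] by simp
    \<comment> \<open>With equal complexity \<open>l\<close> in the window, \<open>A\<close> gives
      the same answer on \<open>(x p, l)\<close> and \<open>(x p', l)\<close>, and one program
      cannot print two different words.\<close>
    have "inj_on C (?P - ?D)"
    proof (rule inj_onI)
      fix p p' assume p: "p \<in> ?P - ?D" "p' \<in> ?P - ?D" and eq: "C p = C p'"
      have sig: "\<exists>q. eval_tm U q = Some (x r) \<and> signature k t' (X r) (C r) = bval q" if "r \<in> ?P" for r
      proof -
        have len: "length (x r) = n" by (simp add: x_def)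
        obtain q where q: "outputs_within A (pair_code (x r) (binary (C r))) (t n) q"
            "short_program U (real n / (4 * real j)) (x r) q"
          using A[of "x r"] unfolding len C_def by blast
        \<comment> \<open>The choice of \<open>n\<close> makes the permitted excess exactly
          \<open>k\<close>.\<close>
        have "real n / (4 * real j) = real k" by (simp add: n j_def field_simps)
        then have "length q \<le> C r + k" using q(2) unfolding short_program_def C_def by simp
        also have "\<dots> \<le> 3 * k" using C_le[OF that] \<open>j \<le> k\<close> by (simp add: j_def)
        finally have "signature k t' (X r) (C r) = bval q"
          using signature_eq_bval[OF k_def, of "X r" "C r" "t n" q t'] q(1) t' by (simp add: x_def n_def)
        then show ?thesis using q(2) unfolding short_program_def by blast
      qed
      obtain q where q: "eval_tm U q = Some (x p)" "signature k t' (X p) (C p) = bval q"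
        using sig p by blast
      obtain q' where q': "eval_tm U q' = Some (x p')" "signature k t' (X p') (C p') = bval q'"
        using sig p by blast
      \<comment> \<open>Outside \<open>?D\<close> the subtraction does not truncate and gives the
        offset of \<open>C p\<close> in the window.\<close>
      have i: "C p - (k - 1) < j" "k - 1 + (C p - (k - 1)) = C p"
        using p C_le[of p] by (auto simp: j_def)
      have j: "pfst k = j" by (simp add: k_def)
      have "signature k t' (X r) (C p) = signature k t' (leader k t') (C p)" if "r \<in> ?P" for r
        using X(2)[OF that] i unfolding same_def j by metis
      then have "bval q = bval q'" using p q(2) q'(2) eq by simp
      then have "x p = x p'" using q(1) q'(1) bval_inj by fastforce
      then show "p = p'" using inj_x p by (auto dest: inj_onD)
    qed
    moreover have "C ` (?P - ?D) \<subseteq> {k - 1..k + c}" using C_le by auto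
    ultimately have "card (?P - ?D) \<le> c + 2"
      using card_inj_on_le[of C "?P - ?D" "{k - 1..k + c}"] by simp
    moreover have "card ?P = card ?D + card (?P - ?D)"
      using P(1) by (subst card_Un_disjoint[symmetric]) (auto intro: arg_cong[where f = card])
    \<comment> \<open>Cancelling half of the words leaves \<open>2 ^ (k - 1) \<le> c + 2\<close>,
      which is impossible as \<open>k\<close> is at least \<open>c + 3\<close>.\<close>
    ultimately have "2 ^ k \<le> 2 ^ (k - 1) + (c + 2)" using D P(2) by linarith
    moreover obtain k' where k': "k = Suc k'" using \<open>j \<le> k\<close> by (cases k) (auto simp: j_def)
    ultimately have "2 ^ k' \<le> c + 2" by simp
    moreover have "k' < 2 ^ k'" by (rule less_exp)
    ultimately show False using \<open>j \<le> k\<close> unfolding j_def k' by linarith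
  qed
  moreover have "4 * real j > 0" by (simp add: j_def)
  ultimately show ?thesis by blast
qed

end
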